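(* Let $G$ be a finite group, let $p$ be a prime dividing $|G|$, and let $P$ be a Sylow $p$-subgroup of $G$. Assume that for every Sylow $p$-subgroup $Q$ of $G$ such that $P\cap Q$ is a tame intersection and $Z_{p-1}(P)<P\cap Q<P$ (strict inclusions), the group $N_G(P\cap Q)$ is $p$-nilpotent. Then $N_G(P)$ controls $p$-transfer in $G$.
   Context: All groups are finite. $Z_k(P)$ denotes the $k$-th term of the upper central series of $P$ ($Z_0(P)=1$, $Z_1(P)=Z(P)$, $Z_{k+1}(P)/Z_k(P)=Z(P/Z_k(P))$). A group is $p$-nilpotent if it has a normal Hall $p'$-subgroup (a normal $p$-complement). For Sylow $p$-subgroups $P,Q$ of $G$ (possibly $P=Q$), $P\cap Q$ is called a tame intersection if both $N_P(P\cap Q)$ and $N_Q(P\cap Q)$ are Sylow $p$-subgroups of $N_G(P\cap Q)$. $A^p(G)$ denotes the smallest normal subgroup of $G$ whose quotient is an abelian $p$-group. If $N\le G$ has index coprime to $p$, then $N$ controls $p$-transfer in $G$ if $N/A^p(N)\cong G/A^p(G)$. *)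

theory Defs
  imports "HOL-Algebra.Sylow" "HOL-Algebra.Zassenhaus"
begin

definition p_group :: "nat \<Rightarrow> ('a, 'b) monoid_scheme \<Rightarrow> bool"
  where "p_group p G \<longleftrightarrow> (\<exists>n. order G = p ^ n)"

definition sylow_subgroup :: "nat \<Rightarrow> ('a, 'b) monoid_scheme \<Rightarrow> 'a set \<Rightarrow> bool"
  where "sylow_subgroup p G P \<longleftrightarrow> subgroup P G \<and> card P = p ^ multiplicity p (order G)"

definition group_center :: "('a, 'b) monoid_scheme \<Rightarrow> 'a set"
  where "group_center G =
    {z \<in> carrier G. \<forall>g \<in> carrier G. z \<otimes>\<^bsub>G\<^esub> g = g \<otimes>\<^bsub>G\<^esub> z}"

(* The successor step is the full preimage in G of the center of G / Z_k(G),
   that is, Z_{k+1}(G) / Z_k(G) = Z(G / Z_k(G)). *)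
primrec upper_central :: "('a, 'b) monoid_scheme \<Rightarrow> nat \<Rightarrow> 'a set" where
  "upper_central G 0 = {\<one>\<^bsub>G\<^esub>}"
| "upper_central G (Suc k) =
    {x \<in> carrier G. upper_central G k #>\<^bsub>G\<^esub> x \<in> group_center (G Mod upper_central G k)}"

(* K is a normal Hall p'-subgroup: its order is prime to p and its index is a power of p. *)
definition p_nilpotent :: "nat \<Rightarrow> ('a, 'b) monoid_scheme \<Rightarrow> bool"
  where "p_nilpotent p G \<longleftrightarrow>
    (\<exists>K. K \<lhd> G \<and> coprime (card K) p \<and> (\<exists>n. card (rcosets\<^bsub>G\<^esub> K) = p ^ n))"

(* Intended for Sylow p-subgroups P and Q of G. *)
definition tame_intersection ::
    "nat \<Rightarrow> ('a, 'b) monoid_scheme \<Rightarrow> 'a set \<Rightarrow> 'a set \<Rightarrow> bool"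
  where "tame_intersection p G P Q \<longleftrightarrow>
    sylow_subgroup p (G\<lparr>carrier := normalizer G (P \<inter> Q)\<rparr>)
      (normalizer (G\<lparr>carrier := P\<rparr>) (P \<inter> Q)) \<and>
    sylow_subgroup p (G\<lparr>carrier := normalizer G (P \<inter> Q)\<rparr>)
      (normalizer (G\<lparr>carrier := Q\<rparr>) (P \<inter> Q))"

(* A^p(G); LEAST refers to inclusion of subsets of G. *)
definition abelian_p_residual :: "nat \<Rightarrow> ('a, 'b) monoid_scheme \<Rightarrow> 'a set"
  where "abelian_p_residual p G =
    (LEAST N. N \<lhd> G \<and> comm_group (G Mod N) \<and> p_group p (G Mod N))"

definition controls_p_transfer :: "nat \<Rightarrow> ('a, 'b) monoid_scheme \<Rightarrow> 'a set \<Rightarrow> bool"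
  where "controls_p_transfer p G N \<longleftrightarrow>
    subgroup N G \<and> coprime (card (rcosets\<^bsub>G\<^esub> N)) p \<and>
    (G\<lparr>carrier := N\<rparr>) Mod abelian_p_residual p (G\<lparr>carrier := N\<rparr>)
      \<cong> G Mod abelian_p_residual p G"

end

theory Submission
  imports Defs "HOL-Algebra.Multiplicative_Group"
begin

text \<open>Write \<open>N = N_G(P)\<close>, let \<open>A\<close> be an abelian \<open>p\<close>-group and \<open>\<lambda> : N \<rightarrow> A\<close> a homomorphism. Everything
reduces to the claim that \<open>\<lambda>\<close> is trivial as soon as its transfer \<open>G \<rightarrow> A\<close> is trivial
(\<open>lam_trivial_if_transfer_trivial\<close>). Indeed, with \<open>m\<close> the number of Sylow subgroups, the homomorphism
\<open>\<lambda>^m / tr \<lambda>\<close> on \<open>N\<close> has trivial transfer, so \<open>\<lambda>^m\<close> is the restriction of \<open>tr \<lambda>\<close> and kills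
\<open>N \<inter> A^p(G)\<close>; since \<open>m\<close> is prime to \<open>p\<close>, so does \<open>\<lambda>\<close>. For the projection \<open>\<lambda>\<close> of \<open>N\<close>
onto \<open>N/A^p(N)\<close> this says \<open>N \<inter> A^p(G) = A^p(N)\<close>, and \<open>N\<close> maps onto \<open>G/A^p(G)\<close> because its
index is prime to \<open>p\<close>.

For the claim, let \<open>u\<close> be an element of minimal order with \<open>\<lambda> u \<noteq> 1\<close>; it is a \<open>p\<close>-element and lies
in \<open>P\<close>. The transfer is a product over all Sylow subgroups. Orbits of \<open>u\<close> of length greater than one
contribute values of \<open>\<lambda>\<close> on proper powers of \<open>u\<close>, which are trivial by minimality. What is left is
the product of \<open>\<lambda>_Q u\<close> over the Sylow subgroups \<open>Q\<close> containing \<open>u\<close>, where \<open>\<lambda>_Q\<close> is the conjugate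
of \<open>\<lambda>\<close> living on \<open>Q\<close> (\<open>transfer_eq_finprod_containing\<close>). The factor at \<open>Q = P\<close> is \<open>\<lambda> u\<close>. With
\<open>Z = Z_(p-1)(P)\<close>, all other factors cancel:

\<^item> If \<open>Z \<subseteq> Q\<close> fails, or if \<open>P \<inter> Q = Z\<close>, the Sylow subgroups fall into blocks of \<open>p\<close> conjugates
  under an element \<open>x\<close> of \<open>P\<close> with \<open>x^p \<in> Q\<close> for which the \<open>(p-1)\<close>-fold commutator
  \<open>[u, x, ..., x]\<close> is trivial. The product over a block is a sum \<open>1 + x + ... + x^(p-1)\<close> applied
  to values of order dividing \<open>p\<close>, hence agrees with \<open>(x - 1)^(p-1)\<close>, which is zero.

\<^item> If \<open>Z < P \<inter> Q < P\<close>, then \<open>\<lambda>_Q\<close> and \<open>\<lambda>\<close> agree on \<open>P \<inter> Q\<close> (\<open>lam_at_agree\<close>). This is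
  Alperin's argument: a chain of tame intersections leads from \<open>P\<close> to \<open>Q\<close>, and in a \<open>p\<close>-nilpotent
  normalizer two Sylow subgroups are conjugate under an element that centralizes the intersection.
  All factors are equal to \<open>\<lambda> u\<close>, and their number is divisible by \<open>p\<close>.

Hence \<open>tr \<lambda> u = \<lambda> u\<close>, which contradicts the triviality of the transfer.\<close>

section \<open>Group actions of p-groups and conjugation\<close>

text \<open>The moved points form an invariant set whose orbits have length a power of \<open>p\<close> different from one.
This divisibility yields the conjugacy of Sylow subgroups, the growth of normalizers and the counts of
Sylow subgroups below.\<close>

lemma (in group) p_dvd_card_moved_points:
  assumes ord: "order G = p ^ n" and p: "Factorial_Ring.prime (p::nat)"
    and E: "finite E"
    and act_closed: "\<And>g x. g \<in> carrier G \<Longrightarrow> x \<in> E \<Longrightarrow> act g x \<in> E"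
    and act_mult: "\<And>g h x. g \<in> carrier G \<Longrightarrow> h \<in> carrier G \<Longrightarrow> x \<in> E \<Longrightarrow> act (g \<otimes> h) x = act g (act h x)"
    and act_one: "\<And>x. x \<in> E \<Longrightarrow> act \<one> x = x"
  shows "p dvd card {x \<in> E. \<exists>g\<in>carrier G. act g x \<noteq> x}"
proof -
  define M where "M = {x \<in> E. \<exists>g\<in>carrier G. act g x \<noteq> x}"
  have inv_act: "act (inv g) (act g x) = x" if "g \<in> carrier G" "x \<in> E" for g x
    using act_mult[of "inv g" g x] that act_one by simp
  have M_closed: "act g x \<in> M" if g: "g \<in> carrier G" and x: "x \<in> M" for g x
  proof -
    obtain h where h: "h \<in> carrier G" "act h x \<noteq> x" using x M_def by auto
    have xE: "x \<in> E" using x M_def by auto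
    have "act (g \<otimes> h \<otimes> inv g) (act g x) = act g (act h x)"
      using g h xE by (simp add: act_mult act_closed inv_act)
    moreover have "act g (act h x) \<noteq> act g x"
      using g h xE inv_act act_closed by metis
    ultimately show ?thesis
      unfolding M_def using g h xE act_closed by (auto intro!: bexI[of _ "g \<otimes> h \<otimes> inv g"])
  qed
  let ?phi = "\<lambda>g. \<lambda>x\<in>M. act g x"
  have ME: "M \<subseteq> E" by (auto simp: M_def)
  have bij: "?phi g \<in> Bij M" if g: "g \<in> carrier G" for g
  proof -
    have "bij_betw (act g) M M"
    proof (rule bij_betw_byWitness[where f' = "act (inv g)"])
      show "\<forall>a\<in>M. act (inv g) (act g a) = a" using inv_act g ME by blast
      show "\<forall>a'\<in>M. act g (act (inv g) a') = a'"
        using inv_act[of "inv g"] g ME by (metis inv_closed inv_inv subsetD)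
      show "act g ` M \<subseteq> M" "act (inv g) ` M \<subseteq> M" using M_closed g by auto
    qed
    then show ?thesis by (simp add: Bij_def bij_betw_restrict_eq)
  qed
  have "?phi \<in> hom G (BijGroup M)"
  proof (rule homI)
    fix g h assume g: "g \<in> carrier G" and h: "h \<in> carrier G"
    have "?phi g \<otimes>\<^bsub>BijGroup M\<^esub> ?phi h = compose M (?phi g) (?phi h)"
      using bij[OF g] bij[OF h] by (simp add: BijGroup_def)
    also have "\<dots> = ?phi (g \<otimes> h)"
      unfolding compose_def
    proof (rule restrict_ext)
      fix x assume x: "x \<in> M"
      then have "x \<in> E" using ME by auto
      then show "?phi g (?phi h x) = act (g \<otimes> h) x"
        using x M_closed[OF h x] act_mult[OF g h] by simp
    qed
    finally show "?phi (g \<otimes> h) = ?phi g \<otimes>\<^bsub>BijGroup M\<^esub> ?phi h" by simp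
  qed (use bij in \<open>auto simp: BijGroup_def\<close>)
  then interpret A: group_action G M ?phi
    unfolding group_action_def group_hom_def group_hom_axioms_def
    using group_BijGroup is_group by auto
  have fin: "finite M" using E ME finite_subset by auto
  have fG: "finite (carrier G)"
    using ord p by (metis card.infinite order_def power_eq_0_iff not_prime_0)
  have "p dvd card (orbit G ?phi x)" if x: "x \<in> M" for x
  proof -
    have "card (orbit G ?phi x) dvd p ^ n"
      using A.orbit_stabilizer_theorem[OF x] ord by (metis dvd_triv_left)
    then obtain k where k: "card (orbit G ?phi x) = p ^ k"
      using p by (metis divides_primepow_nat)
    obtain g where g: "g \<in> carrier G" "act g x \<noteq> x" using x M_def by auto
    have "x \<in> orbit G ?phi x" using x by (rule A.orbit_refl)
    moreover have "act g x \<in> orbit G ?phi x" using g x by (auto simp: orbit_def)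
    ultimately have "card (orbit G ?phi x) \<noteq> 1"
      using g(2) by (auto simp: card_1_singleton_iff)
    then show ?thesis using k by (cases k) auto
  qed
  then have "\<forall>C\<in>orbits G M ?phi. p dvd card C"
    unfolding orbits_def by blast
  moreover have U: "\<Union> (orbits G M ?phi) = M" by (rule A.orbits_coverture)
  moreover have "\<forall>C\<in>orbits G M ?phi. \<forall>D\<in>orbits G M ?phi. C \<noteq> D \<longrightarrow> C \<inter> D = {}"
    using A.disjoint_union by blast
  ultimately have "p dvd card (\<Union> (orbits G M ?phi))"
    using fin by (intro dvd_partition) auto
  then have "p dvd card M" by (simp only: U)
  then show ?thesis by (simp add: M_def)
qed

text \<open>Conjugation of subsets from the left, as an image rather than as a composition of two cosets, so that
membership and cardinality reduce to the injective map on elements.\<close>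

definition conj_set :: "('a, 'b) monoid_scheme \<Rightarrow> 'a \<Rightarrow> 'a set \<Rightarrow> 'a set"
  where "conj_set G g S = (\<lambda>x. g \<otimes>\<^bsub>G\<^esub> x \<otimes>\<^bsub>G\<^esub> inv\<^bsub>G\<^esub> g) ` S"

text \<open>\<open>N_H(R)\<close> for subgroups \<open>H\<close> and \<open>R\<close> of one group \<open>G\<close>. Keeping \<open>G\<close> fixed avoids moving between
the groups carried by \<open>H\<close> whenever a normalizer is intersected or conjugated.\<close>

definition norm_in :: "('a, 'b) monoid_scheme \<Rightarrow> 'a set \<Rightarrow> 'a set \<Rightarrow> 'a set"
  where "norm_in G H R = {h \<in> H. conj_set G h R = R}"

context group
begin

lemma inv_cancel_left:
  assumes "g \<in> carrier G" "x \<in> carrier G"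
  shows "inv g \<otimes> (g \<otimes> x) = x" "g \<otimes> (inv g \<otimes> x) = x"
  using assms by (simp_all flip: m_assoc)

lemma conj_mult:
  assumes "g \<in> carrier G" "x \<in> carrier G" "y \<in> carrier G"
  shows "g \<otimes> (x \<otimes> y) \<otimes> inv g = (g \<otimes> x \<otimes> inv g) \<otimes> (g \<otimes> y \<otimes> inv g)"
  using assms by (simp add: m_assoc inv_cancel_left)

lemma conj_inv:
  assumes "g \<in> carrier G" "x \<in> carrier G"
  shows "inv (g \<otimes> x \<otimes> inv g) = g \<otimes> inv x \<otimes> inv g"
  using assms by (simp add: inv_mult_group m_assoc)

lemma conj_cancel:
  assumes "g \<in> carrier G" "x \<in> carrier G"
  shows "inv g \<otimes> (g \<otimes> x \<otimes> inv g) \<otimes> g = x" "g \<otimes> (inv g \<otimes> x \<otimes> g) \<otimes> inv g = x"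
  using assms by (simp_all add: m_assoc inv_cancel_left)

lemma conj_set_subset [simp]:
  "g \<in> carrier G \<Longrightarrow> S \<subseteq> carrier G \<Longrightarrow> conj_set G g S \<subseteq> carrier G"
  by (auto simp: conj_set_def)

lemma mem_conj_set:
  assumes "g \<in> carrier G" "S \<subseteq> carrier G"
  shows "x \<in> conj_set G g S \<longleftrightarrow> x \<in> carrier G \<and> inv g \<otimes> x \<otimes> g \<in> S"
proof
  assume "x \<in> conj_set G g S"
  then show "x \<in> carrier G \<and> inv g \<otimes> x \<otimes> g \<in> S"
    using assms conj_cancel(1) by (auto simp: conj_set_def subset_iff)
next
  assume "x \<in> carrier G \<and> inv g \<otimes> x \<otimes> g \<in> S"
  then show "x \<in> conj_set G g S"
    using assms conj_cancel(2)[of g x] unfolding conj_set_def by (metis image_eqI)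
qed

lemma conj_set_mult:
  assumes "g \<in> carrier G" "h \<in> carrier G" "S \<subseteq> carrier G"
  shows "conj_set G (g \<otimes> h) S = conj_set G g (conj_set G h S)"
  using assms unfolding conj_set_def image_image
  by (intro image_cong) (auto simp: m_assoc inv_mult_group subset_iff)

lemma conj_set_one: "S \<subseteq> carrier G \<Longrightarrow> conj_set G \<one> S = S"
  unfolding conj_set_def by (force simp: subset_iff)

lemma conj_set_inv_cancel:
  assumes "g \<in> carrier G" "S \<subseteq> carrier G"
  shows "conj_set G (inv g) (conj_set G g S) = S" "conj_set G g (conj_set G (inv g) S) = S"
  using conj_set_mult[of "inv g" g S] conj_set_mult[of g "inv g" S] assms by (simp_all add: conj_set_one)

lemma conj_set_mono: "S \<subseteq> T \<Longrightarrow> conj_set G g S \<subseteq> conj_set G g T"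
  by (auto simp: conj_set_def)

lemma conj_set_psubset:
  assumes "g \<in> carrier G" "S \<subset> T" "T \<subseteq> carrier G"
  shows "conj_set G g S \<subset> conj_set G g T"
  using assms conj_set_mono[of S T g] conj_set_inv_cancel(1)[of g] by (metis psubset_eq subset_trans)

lemma conj_set_Int:
  assumes "g \<in> carrier G" "S \<subseteq> carrier G" "T \<subseteq> carrier G"
  shows "conj_set G g (S \<inter> T) = conj_set G g S \<inter> conj_set G g T"
  using assms mem_conj_set[of g "S \<inter> T"] mem_conj_set[of g S] mem_conj_set[of g T] by blast

lemma inj_on_conj: "g \<in> carrier G \<Longrightarrow> S \<subseteq> carrier G \<Longrightarrow> inj_on (\<lambda>x. g \<otimes> x \<otimes> inv g) S"
  by (rule inj_onI) (metis conjugation_is_inj subsetD)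

lemma card_conj_set: "g \<in> carrier G \<Longrightarrow> S \<subseteq> carrier G \<Longrightarrow> card (conj_set G g S) = card S"
  by (simp add: conj_set_def card_image inj_on_conj)

lemma subgroup_conj_set:
  assumes "g \<in> carrier G" "subgroup H G"
  shows "subgroup (conj_set G g H) G"
proof -
  have H: "H \<subseteq> carrier G" using assms subgroup.subset by auto
  show ?thesis
  proof (rule subgroupI)
    show "conj_set G g H \<subseteq> carrier G" using assms H by simp
    show "conj_set G g H \<noteq> {}" using subgroup.one_closed[OF assms(2)] by (auto simp: conj_set_def)
  next
    fix a assume "a \<in> conj_set G g H"
    then show "inv a \<in> conj_set G g H"
      using assms H subgroup.m_inv_closed[OF assms(2)]
      by (auto simp: conj_set_def conj_inv subset_iff intro!: image_eqI)
  next
    fix a b assume "a \<in> conj_set G g H" "b \<in> conj_set G g H"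
    then obtain x y where xy: "x \<in> H" "y \<in> H" "a = g \<otimes> x \<otimes> inv g" "b = g \<otimes> y \<otimes> inv g"
      by (auto simp: conj_set_def)
    then have "a \<otimes> b = g \<otimes> (x \<otimes> y) \<otimes> inv g"
      using assms H conj_mult[of g x y] by (simp add: subset_iff)
    then show "a \<otimes> b \<in> conj_set G g H"
      using xy subgroup.m_closed[OF assms(2)] by (auto simp: conj_set_def)
  qed
qed

lemma conj_set_self:
  assumes "subgroup H G" "h \<in> H"
  shows "conj_set G h H = H"
proof -
  have H: "H \<subseteq> carrier G" using assms subgroup.subset by auto
  have "inv h \<otimes> x \<otimes> h \<in> H \<longleftrightarrow> x \<in> H" if "x \<in> carrier G" for x
    using that assms H conj_cancel(2)[of h x] subgroup.m_closed[OF assms(1)] subgroup.m_inv_closed[OF assms(1)]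
    by (metis subsetD)
  then show ?thesis using mem_conj_set[of h H] assms(2) H by blast
qed

lemma subgroup_norm_in:
  assumes "subgroup H G" "R \<subseteq> carrier G"
  shows "subgroup (norm_in G H R) G"
proof -
  have H: "H \<subseteq> carrier G" using assms subgroup.subset by auto
  show ?thesis
  proof (rule subgroupI)
    show "norm_in G H R \<subseteq> carrier G" using H by (auto simp: norm_in_def)
    show "norm_in G H R \<noteq> {}"
      using conj_set_one[OF assms(2)] subgroup.one_closed[OF assms(1)] by (auto simp: norm_in_def)
  next
    fix a assume "a \<in> norm_in G H R"
    then show "inv a \<in> norm_in G H R"
      using assms H conj_set_inv_cancel(1)[of a R] subgroup.m_inv_closed[OF assms(1)]
      by (auto simp: norm_in_def subset_iff)
  next
    fix a b assume "a \<in> norm_in G H R" "b \<in> norm_in G H R"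
    then show "a \<otimes> b \<in> norm_in G H R"
      using assms H subgroup.m_closed[OF assms(1)]
      by (auto simp: norm_in_def subset_iff conj_set_mult)
  qed
qed

lemma norm_in_conj:
  assumes "g \<in> carrier G" "H \<subseteq> carrier G" "R \<subseteq> carrier G"
  shows "norm_in G (conj_set G g H) (conj_set G g R) = conj_set G g (norm_in G H R)"
proof -
  have eq: "conj_set G x (conj_set G g R) = conj_set G g R \<longleftrightarrow> conj_set G (inv g \<otimes> x \<otimes> g) R = R"
    if x: "x \<in> carrier G" for x
  proof -
    have "conj_set G (inv g \<otimes> x \<otimes> g) R = conj_set G (inv g) (conj_set G x (conj_set G g R))"
      using assms x by (simp add: conj_set_mult)
    then show ?thesis
      using assms x conj_set_inv_cancel[of g] conj_set_subset by metis
  qed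
  have sub: "norm_in G H R \<subseteq> carrier G" using assms by (auto simp: norm_in_def)
  show ?thesis
  proof (rule Set.set_eqI)
    fix x
    show "x \<in> norm_in G (conj_set G g H) (conj_set G g R) \<longleftrightarrow> x \<in> conj_set G g (norm_in G H R)"
      using eq[of x] mem_conj_set[OF assms(1) assms(2), of x] mem_conj_set[OF assms(1) sub, of x]
      by (simp only: norm_in_def mem_Collect_eq) blast
  qed
qed

lemma subgroup_in_subgroup:
  "subgroup H G \<Longrightarrow> subgroup K G \<Longrightarrow> H \<subseteq> K \<Longrightarrow> subgroup H (G\<lparr>carrier := K\<rparr>)"
  by (simp add: subgroup_incl)

lemma conj_set_carrier_update:
  assumes "subgroup K G" "g \<in> K"
  shows "conj_set (G\<lparr>carrier := K\<rparr>) g S = conj_set G g S"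
  using assms by (simp add: conj_set_def m_inv_consistent)

lemma norm_in_carrier_update:
  assumes "subgroup K G" "H \<subseteq> K"
  shows "norm_in (G\<lparr>carrier := K\<rparr>) H S = norm_in G H S"
  using assms by (auto simp: norm_in_def conj_set_carrier_update subset_iff)

lemma normalizer_eq_norm_in:
  assumes "R \<subseteq> carrier G"
  shows "normalizer G R = norm_in G (carrier G) R"
proof -
  have "(g <# R) #> inv g = conj_set G g R" for g
    by (auto simp: l_coset_def r_coset_def conj_set_def)
  then show ?thesis using assms by (simp add: normalizer_def stabilizer_def norm_in_def)
qed

lemma normalizer_subgroup_eq_norm_in:
  assumes "subgroup K G" "R \<subseteq> K"
  shows "normalizer (G\<lparr>carrier := K\<rparr>) R = norm_in G K R"
  using group.normalizer_eq_norm_in[OF subgroup_imp_group[OF assms(1)], of R] assms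
    norm_in_carrier_update[of K K R] by simp

end

section \<open>Sylow subgroups\<close>

lemma not_dvd_cofactor:
  assumes "Factorial_Ring.prime (p::nat)" "n > 0" "n = m * p ^ multiplicity p n"
  shows "\<not> p dvd m"
proof
  assume "p dvd m"
  then have "p ^ Suc (multiplicity p n) dvd n" using assms(3) by (metis mult_dvd_mono dvd_refl power_Suc)
  then have "Suc (multiplicity p n) \<le> multiplicity p n"
    using assms by (subst (asm) power_dvd_iff_le_multiplicity) auto
  then show False by simp
qed

lemma dvd_card_complement:
  assumes "finite X" "(p::nat) dvd card X" "p dvd card {x \<in> X. Q x}"
  shows "p dvd card {x \<in> X. \<not> Q x}"
proof -
  have "card ({x \<in> X. Q x} \<union> {x \<in> X. \<not> Q x}) = card {x \<in> X. Q x} + card {x \<in> X. \<not> Q x}"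
    using assms(1) by (intro card_Un_disjoint) auto
  moreover have "{x \<in> X. Q x} \<union> {x \<in> X. \<not> Q x} = X" by auto
  ultimately have "card X = card {x \<in> X. Q x} + card {x \<in> X. \<not> Q x}" by simp
  then show ?thesis using assms(2,3) by (metis dvd_add_right_iff)
qed

context group
begin

lemma card_subgroup_dvd: "subgroup H G \<Longrightarrow> card H dvd order G"
  using lagrange by (metis dvd_triv_right)

lemma p_dvd_card_conj_moved:
  assumes H: "subgroup H G" "card H = p ^ n" and p: "Factorial_Ring.prime (p::nat)"
    and X: "finite X" "\<And>Q. Q \<in> X \<Longrightarrow> Q \<subseteq> carrier G"
    and closed: "\<And>h Q. h \<in> H \<Longrightarrow> Q \<in> X \<Longrightarrow> conj_set G h Q \<in> X"
  shows "p dvd card {Q \<in> X. \<exists>h\<in>H. conj_set G h Q \<noteq> Q}"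
proof -
  interpret H: group "G\<lparr>carrier := H\<rparr>" using H subgroup_imp_group by auto
  have HG: "h \<in> carrier G" if "h \<in> H" for h using that subgroup.subset[OF H(1)] by auto
  show ?thesis
    using H.p_dvd_card_moved_points[where E = X and act = "\<lambda>h. conj_set G h" and n = n and p = p]
      H p X closed HG by (simp add: order_def conj_set_mult conj_set_one)
qed

lemma p_dvd_card_cosets_moved:
  assumes H: "subgroup H G" "card H = p ^ n" and p: "Factorial_Ring.prime (p::nat)"
    and K: "subgroup K G" and fin: "finite (carrier G)"
  shows "p dvd card {C \<in> rcosets K. \<exists>h\<in>H. C #> inv h \<noteq> C}"
proof -
  interpret H: group "G\<lparr>carrier := H\<rparr>" using H subgroup_imp_group by auto
  have HG: "h \<in> carrier G" if "h \<in> H" for h using that subgroup.subset[OF H(1)] by auto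
  have KG: "K \<subseteq> carrier G" using subgroup.subset[OF K] .
  have CG: "C \<subseteq> carrier G" if "C \<in> rcosets K" for C
    using that subgroup.rcosets_carrier[OF K is_group] by auto
  have "finite (rcosets K)" using finite_subset[OF rcosets_subset_PowG[OF K]] fin by simp
  moreover have "C #> inv h \<in> rcosets K" if "h \<in> H" "C \<in> rcosets K" for h C
    using that KG HG by (auto simp: RCOSETS_def coset_mult_assoc)
  moreover have "C #> inv (g \<otimes> h) = C #> inv h #> inv g" if "g \<in> H" "h \<in> H" "C \<in> rcosets K" for g h C
    using that CG[OF that(3)] HG by (simp add: coset_mult_assoc inv_mult_group)
  moreover have "C #> inv \<one> = C" if "C \<in> rcosets K" for C
    using CG[OF that] by simp
  ultimately show ?thesis
    using H.p_dvd_card_moved_points[where E = "rcosets K" and act = "\<lambda>h C. C #> inv h" and n = n and p = p]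
      H p by (simp add: order_def)
qed

lemma fixed_coset_imp_subset_conj:
  assumes "subgroup H G" "subgroup K G" "a \<in> carrier G"
    and fixd: "\<And>h. h \<in> H \<Longrightarrow> K #> a #> inv h = K #> a"
  shows "H \<subseteq> conj_set G (inv a) K"
proof
  fix h assume h: "h \<in> H"
  have KG: "K \<subseteq> carrier G" and hG: "h \<in> carrier G"
    using subgroup.subset assms(1,2) h by blast+
  have "inv h \<in> H" using h assms(1) by (simp add: subgroup.m_inv_closed)
  then have "K #> (a \<otimes> h) = K #> a"
    using fixd[of "inv h"] assms(3) KG hG by (simp add: coset_mult_assoc)
  then have "a \<otimes> h \<in> K #> a"
    using rcos_self[OF _ assms(2), of "a \<otimes> h"] assms(3) hG by simp
  then obtain k where k: "k \<in> K" "a \<otimes> h = k \<otimes> a" by (auto simp: r_coset_def)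
  then have "a \<otimes> h \<otimes> inv a = k" using assms(3) KG hG by (auto simp: m_assoc subset_iff)
  then show "h \<in> conj_set G (inv a) K"
    using k(1) mem_conj_set[of "inv a" K h] assms(3) KG hG by simp
qed

text \<open>\<open>H\<close> acts by right multiplication on the cosets of \<open>S\<close>. Their number is prime to \<open>p\<close>, so some coset
is fixed.\<close>

lemma p_subgroup_subset_conj_sylow:
  assumes fin: "finite (carrier G)" and p: "Factorial_Ring.prime (p::nat)"
    and S: "subgroup S G" "card S = p ^ multiplicity p (order G)"
    and H: "subgroup H G" "card H = p ^ n"
  shows "\<exists>g\<in>carrier G. H \<subseteq> conj_set G g S"
proof -
  have "card (rcosets S) * card S = order G" using lagrange[OF S(1)] .
  then have "\<not> p dvd card (rcosets S)"
    using not_dvd_cofactor[OF p] S fin by (metis order_gt_0_iff_finite)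
  then have "{C \<in> rcosets S. \<exists>h\<in>H. C #> inv h \<noteq> C} \<noteq> rcosets S"
    using p_dvd_card_cosets_moved[OF H p S(1) fin] by auto
  then obtain C where "C \<in> rcosets S" and C: "\<And>h. h \<in> H \<Longrightarrow> C #> inv h = C" by blast
  then obtain a where a: "a \<in> carrier G" "C = S #> a" by (auto simp: RCOSETS_def)
  have "H \<subseteq> conj_set G (inv a) S"
    using fixed_coset_imp_subset_conj[OF H(1) S(1) a(1)] C a(2) by auto
  then show ?thesis using a(1) by blast
qed

text \<open>The action of \<open>R\<close> on its own cosets in \<open>Q\<close> fixes the coset \<open>R\<close>. The number of fixed cosets is
divisible by \<open>p\<close>, so there is a further one, and its representative normalizes \<open>R\<close>.\<close>

lemma normalizer_grows:
  assumes fin: "finite (carrier G)" and p: "Factorial_Ring.prime (p::nat)"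
    and Q: "subgroup Q G" "card Q = p ^ n"
    and R: "subgroup R G" "R \<subset> Q"
  shows "\<exists>y\<in>Q - R. conj_set G y R = R"
proof -
  let ?Q = "G\<lparr>carrier := Q\<rparr>"
  interpret Q: group ?Q using Q subgroup_imp_group by auto
  have QG: "Q \<subseteq> carrier G" using subgroup.subset[OF Q(1)] .
  have finQ: "finite Q" using fin QG finite_subset by auto
  have RQ: "subgroup R ?Q" using subgroup_in_subgroup[OF R(1) Q(1)] R(2) by auto
  have "card R dvd p ^ n" using Q.card_subgroup_dvd[OF RQ] Q by (simp add: order_def)
  then obtain k where k: "card R = p ^ k" using p by (metis divides_primepow_nat)
  let ?X = "rcosets\<^bsub>?Q\<^esub> R"
  have lag: "card ?X * card R = card Q" using Q.lagrange[OF RQ] by (simp add: order_def)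
  have "card R < card Q" using R(2) finQ psubset_card_mono by blast
  then have "card ?X \<noteq> 1" using lag by auto
  moreover have "card ?X dvd p ^ n" using lag Q(2) by (metis dvd_triv_left)
  ultimately have pX: "p dvd card ?X" using p
    by (metis divides_primepow_nat dvd_power gr0I power_0)
  have finX: "finite ?X"
    using finQ Q.rcosets_subset_PowG[OF RQ] by (simp add: finite_subset)
  let ?F = "{C \<in> ?X. \<not> (\<exists>h\<in>R. C #>\<^bsub>?Q\<^esub> inv\<^bsub>?Q\<^esub> h \<noteq> C)}"
  have "p dvd card ?F"
    by (rule dvd_card_complement[OF finX pX Q.p_dvd_card_cosets_moved[OF RQ k p RQ]]) (simp add: finQ)
  moreover have "R \<in> ?F"
  proof -
    have "R #>\<^bsub>?Q\<^esub> \<one>\<^bsub>?Q\<^esub> = R" using Q.coset_mult_one subgroup.subset[OF RQ] by blast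
    then have "R \<in> ?X" using Q.one_closed unfolding RCOSETS_def by blast
    moreover have "R #>\<^bsub>?Q\<^esub> inv\<^bsub>?Q\<^esub> h = R" if "h \<in> R" for h
      using that Q.coset_join2[OF _ RQ] subgroup.m_inv_closed[OF RQ] subgroup.subset[OF RQ]
      by (simp add: subset_iff)
    ultimately show ?thesis by simp
  qed
  moreover have "finite ?F" using finX by simp
  ultimately have "?F \<noteq> {R}" using p by (auto dest: prime_gt_1_nat)
  then obtain C where C: "C \<in> ?F" "C \<noteq> R" using \<open>R \<in> ?F\<close> by blast
  then obtain y where y: "y \<in> Q" "C = R #>\<^bsub>?Q\<^esub> y" by (auto simp: RCOSETS_def)
  have yR: "y \<notin> R" using y C(2) Q.coset_join2[OF _ RQ] by auto
  have iy: "inv\<^bsub>?Q\<^esub> y = inv y" using m_inv_consistent[OF Q(1) y(1)] .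
  have "R \<subseteq> conj_set ?Q (inv\<^bsub>?Q\<^esub> y) R"
    using Q.fixed_coset_imp_subset_conj[OF RQ RQ] y C by auto
  moreover have iyQ: "inv y \<in> Q" using y Q(1) by (simp add: subgroup.m_inv_closed)
  ultimately have "R \<subseteq> conj_set G (inv y) R" using conj_set_carrier_update[OF Q(1)] iy by simp
  moreover have "card (conj_set G (inv y) R) = card R" "finite R"
    using card_conj_set[of "inv y" R] iyQ QG R finQ finite_subset[of R Q] by auto
  ultimately have "conj_set G (inv y) R = R"
    using card_subset_eq[of "conj_set G (inv y) R" R] by (simp add: conj_set_def)
  moreover have "inv y \<notin> R"
    using yR subgroup.m_inv_closed[OF R(1), of "inv y"] y(1) QG by auto
  ultimately show ?thesis using iyQ by auto
qed

lemma sylow_of_intermediate: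
  assumes fin: "finite (carrier G)" and p: "Factorial_Ring.prime (p::nat)"
    and S: "subgroup S G" "card S = p ^ multiplicity p (order G)"
    and M: "subgroup M G" "S \<subseteq> M"
  shows "multiplicity p (card M) = multiplicity p (order G)"
proof (rule antisym)
  have pos: "order G > 0" "card M > 0"
    using fin M subgroup.subset[OF M(1)] subgroup.one_closed[OF M(1)]
    by (auto simp: order_gt_0_iff_finite card_gt_0_iff dest: finite_subset)
  show "multiplicity p (card M) \<le> multiplicity p (order G)"
    using pos card_subgroup_dvd[OF M(1)] by (intro dvd_imp_multiplicity_le) auto
  have "card S dvd card M"
    using group.card_subgroup_dvd[OF subgroup_imp_group[OF M(1)] subgroup_in_subgroup[OF S(1) M]]
    by (simp add: order_def)
  then show "multiplicity p (order G) \<le> multiplicity p (card M)"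
    using S(2) pos p by (intro multiplicity_geI) auto
qed

text \<open>Used with \<open>M = N_G(R)\<close> and \<open>H = N_Q(R)\<close>: it provides a Sylow subgroup \<open>U\<close> of \<open>G\<close> above \<open>H\<close> for
which \<open>N_U(R)\<close> is a Sylow subgroup of \<open>N_G(R)\<close>, as required of a tame intersection.\<close>

lemma p_subgroup_extends_to_sylow:
  assumes fin: "finite (carrier G)" and p: "Factorial_Ring.prime (p::nat)"
    and S: "subgroup S G" "card S = p ^ multiplicity p (order G)"
    and M: "subgroup M G"
    and H: "subgroup H G" "card H = p ^ n" "H \<subseteq> M"
  shows "\<exists>g\<in>carrier G. H \<subseteq> conj_set G g S \<and> card (conj_set G g S \<inter> M) = p ^ multiplicity p (card M)"
proof -
  let ?M = "G\<lparr>carrier := M\<rparr>" and ?q = "p ^ multiplicity p (card M)"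
  interpret M: group ?M using M subgroup_imp_group by auto
  have MG: "M \<subseteq> carrier G" using subgroup.subset[OF M] .
  have finM: "finite M" using fin MG finite_subset by auto
  have posM: "card M > 0" using finM subgroup.one_closed[OF M] by (auto simp: card_gt_0_iff)
  obtain m where m: "order ?M = ?q * m"
    using multiplicity_dvd[of p "card M"] by (auto simp: order_def)
  obtain T where T: "subgroup T ?M" "card T = ?q"
    using sylow_thm[OF p M.is_group m] finM by auto
  obtain h where h: "h \<in> M" "H \<subseteq> conj_set ?M h T"
    using M.p_subgroup_subset_conj_sylow[of p T H n] finM p T subgroup_in_subgroup[OF H(1) M H(3)] H(2)
    by (auto simp: order_def)
  let ?T = "conj_set ?M h T"
  have hT: "subgroup ?T ?M" "card ?T = ?q"
    using M.subgroup_conj_set[of h T] M.card_conj_set[of h T] T h subgroup.subset[OF T(1)] by auto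
  have "subgroup ?T G" using hT(1) M incl_subgroup by blast
  then obtain g where g: "g \<in> carrier G" "?T \<subseteq> conj_set G g S"
    using p_subgroup_subset_conj_sylow[OF fin p S] hT(2) by blast
  let ?U = "conj_set G g S \<inter> M"
  have gS: "subgroup (conj_set G g S) G" using subgroup_conj_set[OF g(1) S(1)] .
  have U: "subgroup ?U G" using subgroups_Inter_pair[OF gS M] .
  have "card ?U dvd card (conj_set G g S)"
    using group.card_subgroup_dvd[OF subgroup_imp_group[OF gS] subgroup_in_subgroup[OF U gS]]
    by (simp add: order_def)
  then have "card ?U dvd p ^ multiplicity p (order G)"
    using card_conj_set[OF g(1) subgroup.subset[OF S(1)]] S(2) by simp
  then obtain k where k: "card ?U = p ^ k" using p by (metis divides_primepow_nat)
  have "card ?U dvd card M"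
    using M.card_subgroup_dvd[OF subgroup_in_subgroup[OF U M]] by (simp add: order_def)
  then have "k \<le> multiplicity p (card M)"
    using k posM p by (intro multiplicity_geI) auto
  then have "card ?U \<le> ?q" using k power_increasing[OF _ prime_ge_1_nat[OF p]] by simp
  moreover have "?T \<subseteq> ?U" using g(2) subgroup.subset[OF hT(1)] by auto
  ultimately have "card ?U = ?q"
    using hT(2) card_mono[of ?U ?T] finM by simp
  then show ?thesis using g h(2) by blast
qed

text \<open>\<open>S\<close> is the only Sylow \<open>p\<close>-subgroup of its normalizer.\<close>

lemma p_subgroup_normalizing_sylow:
  assumes fin: "finite (carrier G)" and p: "Factorial_Ring.prime (p::nat)"
    and S: "subgroup S G" "card S = p ^ multiplicity p (order G)"
    and H: "subgroup H G" "card H = p ^ n" "H \<subseteq> norm_in G (carrier G) S"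
  shows "H \<subseteq> S"
proof -
  let ?N = "norm_in G (carrier G) S"
  have SG: "S \<subseteq> carrier G" using subgroup.subset[OF S(1)] .
  have N: "subgroup ?N G" using subgroup_norm_in[OF subgroup_self SG] .
  have SN: "S \<subseteq> ?N" using SG conj_set_self[OF S(1)] by (auto simp: norm_in_def)
  interpret N: group "G\<lparr>carrier := ?N\<rparr>" using N subgroup_imp_group by auto
  have "finite ?N" using fin by (auto simp: norm_in_def)
  then obtain g where g: "g \<in> ?N" "H \<subseteq> conj_set (G\<lparr>carrier := ?N\<rparr>) g S"
    using N.p_subgroup_subset_conj_sylow[of p S H n] p H S(2)
      subgroup_in_subgroup[OF S(1) N SN] subgroup_in_subgroup[OF H(1) N H(3)]
      sylow_of_intermediate[OF fin p S N SN]
    by (auto simp: order_def)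
  then show ?thesis using conj_set_carrier_update[OF N g(1)] by (auto simp: norm_in_def)
qed

lemma card_generate_singleton:
  assumes "finite (carrier G)" "x \<in> carrier G" 
  shows "card (generate G {x}) = ord x"
  using generate_pow_card assms by simp

end

section \<open>Products over orbits in abelian groups\<close>

context comm_monoid
begin

lemma finprod_lessThan_Suc:
  assumes "\<And>i. f i \<in> carrier G"
  shows "finprod G f {..<Suc n} = f n \<otimes> finprod G f {..<n}"
  using assms by (simp add: lessThan_Suc finprod_insert)

lemma finprod_lessThan_Suc_shift:
  assumes "\<And>i. f i \<in> carrier G"
  shows "finprod G f {..<Suc n} = f 0 \<otimes> finprod G (\<lambda>i. f (Suc i)) {..<n}"
proof -
  have "finprod G f {..<Suc n} = f 0 \<otimes> finprod G f (Suc ` {..<n})"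
    using assms by (subst lessThan_Suc_eq_insert_0, subst finprod_insert) auto
  also have "finprod G f (Suc ` {..<n}) = finprod G (\<lambda>i. f (Suc i)) {..<n}"
    using assms by (intro finprod_reindex) auto
  finally show ?thesis .
qed

text \<open>The set \<open>X\<close> is exhausted orbit by orbit. The injectivity premise says that \<open>n\<close> is the exact length of
the orbit of \<open>x\<close>.\<close>

lemma finprod_orbits_eq_one:
  assumes "finite X" "f \<in> X \<rightarrow> X" "inj_on f X" "g \<in> X \<rightarrow> carrier G"
    and orb: "\<And>x n. x \<in> X \<Longrightarrow> 0 < n \<Longrightarrow> (f ^^ n) x = x \<Longrightarrow> inj_on (\<lambda>i. (f ^^ i) x) {..<n}
      \<Longrightarrow> finprod G (\<lambda>i. g ((f ^^ i) x)) {..<n} = \<one>"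
  shows "finprod G g X = \<one>"
  using assms
proof (induction X rule: finite_psubset_induct)
  case (psubset X)
  show ?case
  proof (cases "X = {}")
    case False
    then obtain x where x: "x \<in> X" by blast
    have it: "(f ^^ i) x \<in> X" for i using x psubset.prems(1) by (induction i) auto
    have cancel: "(f ^^ j) x = x" if "(f ^^ (i + j)) x = (f ^^ i) x" for i j
      using that
    proof (induction i)
      case (Suc i)
      then have "f ((f ^^ (i + j)) x) = f ((f ^^ i) x)" by simp
      then show ?case using Suc.IH psubset.prems(2) it by (metis inj_onD)
    qed auto
    have "\<not> inj_on (\<lambda>i. (f ^^ i) x) {..card X}"
    proof
      assume "inj_on (\<lambda>i. (f ^^ i) x) {..card X}"
      then have "card {..card X} \<le> card X"
        using it psubset.hyps(1) by (intro card_inj_on_le[of "\<lambda>i. (f ^^ i) x"]) auto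
      then show False by simp
    qed
    then obtain i j where "i < j" "(f ^^ i) x = (f ^^ j) x"
      unfolding inj_on_def by (metis nat_neq_iff)
    then have ex: "\<exists>n. 0 < n \<and> (f ^^ n) x = x"
      using cancel[of i "j - i"] by (intro exI[of _ "j - i"]) auto
    define n where "n = (LEAST n. 0 < n \<and> (f ^^ n) x = x)"
    have n: "0 < n" "(f ^^ n) x = x" using LeastI_ex[OF ex] by (auto simp: n_def)
    have n_min: "\<not> (0 < m \<and> (f ^^ m) x = x)" if "m < n" for m
      using that not_less_Least unfolding n_def by blast
    have inj: "inj_on (\<lambda>i. (f ^^ i) x) {..<n}"
    proof (rule linorder_inj_onI)
      fix i j assume "i < j" "i \<in> {..<n}" "j \<in> {..<n}"
      then show "(f ^^ i) x \<noteq> (f ^^ j) x"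
        using cancel[of i "j - i"] n_min[of "j - i"] by auto
    qed auto
    let ?O = "(\<lambda>i. (f ^^ i) x) ` {..<n}"
    have OX: "?O \<subseteq> X" using it by auto
    have pull: "y \<in> ?O" if y: "y \<in> X" "f y \<in> ?O" for y
    proof -
      obtain i where i: "i < n" "f y = (f ^^ i) x" using y by auto
      obtain k where k: "k < n" "(f ^^ i) x = f ((f ^^ k) x)"
      proof (cases i)
        case 0
        have "(f ^^ i) x = f ((f ^^ (n - 1)) x)" using 0 n by (cases n) auto
        then show ?thesis using that[of "n - 1"] n(1) by simp
      next
        case (Suc k)
        then show ?thesis using that[of k] i(1) by simp
      qed
      then have "y = (f ^^ k) x" using i(2) psubset.prems(2) y(1) it by (metis inj_onD)
      then show ?thesis using k(1) by blast
    qed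
    have "finprod G g (?O \<union> (X - ?O)) = finprod G g ?O \<otimes> finprod G g (X - ?O)"
      using psubset.hyps(1) OX psubset.prems(3) by (intro finprod_Un_disjoint) auto
    moreover have "?O \<union> (X - ?O) = X" using OX by blast
    ultimately have "finprod G g X = finprod G g ?O \<otimes> finprod G g (X - ?O)" by simp
    also have "finprod G g ?O = finprod G (\<lambda>i. g ((f ^^ i) x)) {..<n}"
      using it psubset.prems(3) inj by (intro finprod_reindex) auto
    also have "\<dots> = \<one>" using psubset.prems(4) x n inj by blast
    also have "finprod G g (X - ?O) = \<one>"
    proof (rule psubset.IH)
      have "x \<in> ?O" using n(1) by (auto intro!: image_eqI[of _ _ 0])
      then show "X - ?O \<subset> X" using x by blast
      show "f \<in> X - ?O \<rightarrow> X - ?O" using psubset.prems(1) pull by blast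
      show "inj_on f (X - ?O)" using psubset.prems(2) inj_on_diff by blast
      show "g \<in> X - ?O \<rightarrow> carrier G" using psubset.prems(3) by auto
    qed (use psubset.prems(4) in auto)
    finally show ?thesis by simp
  qed auto
qed

lemma finprod_blocks_eq_one:
  assumes p: "Factorial_Ring.prime (p::nat)"
    and X: "finite X" "f \<in> X \<rightarrow> X" "inj_on f X" "g \<in> X \<rightarrow> carrier G"
    and per: "\<And>x. x \<in> X \<Longrightarrow> (f ^^ p) x = x" and moved: "\<And>x. x \<in> X \<Longrightarrow> f x \<noteq> x"
    and block: "\<And>x. x \<in> X \<Longrightarrow> finprod G (\<lambda>i. g ((f ^^ i) x)) {..<p} = \<one>"
  shows "finprod G g X = \<one>"
  using X
proof (rule finprod_orbits_eq_one)
  fix x n assume x: "x \<in> X" and n: "0 < n" "(f ^^ n) x = x" and inj: "inj_on (\<lambda>i. (f ^^ i) x) {..<n}"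
  have "(f ^^ (p mod n)) x = x"
    using per[OF x] n(2) by (metis funpow_mod_eq)
  then have "p mod n = 0"
    using inj n(1) inj_onD[OF inj, of "p mod n" 0] by simp
  moreover have "n \<noteq> 1" using n(2) moved[OF x] by auto
  ultimately have "n dvd p" "n \<noteq> 1" by (auto simp: dvd_eq_mod_eq_0)
  then have "n = p" using p unfolding prime_nat_iff by blast
  then show "finprod G (\<lambda>i. g ((f ^^ i) x)) {..<n} = \<one>" using block[OF x] by simp
qed

lemma finprod_fibres_eq_one:
  assumes "finite X" "g \<in> X \<rightarrow> carrier G"
    and fib: "\<And>k. k \<in> key ` X \<Longrightarrow> finprod G g {x \<in> X. key x = k} = \<one>"
  shows "finprod G g X = \<one>"
proof -
  have "X = (\<Union>k\<in>key ` X. {x \<in> X. key x = k})" by auto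
  then have "finprod G g X = finprod G g (\<Union>k\<in>key ` X. {x \<in> X. key x = k})" by simp
  also have "\<dots> = finprod G (\<lambda>k. finprod G g {x \<in> X. key x = k}) (key ` X)"
    using assms(1,2) by (intro finprod_UN_disjoint) (auto simp: Pi_def pairwise_def disjnt_def)
  also have "\<dots> = \<one>" using fib by (rule finprod_one_eqI)
  finally show ?thesis .
qed

end

context comm_group
begin

text \<open>In additive notation, if \<open>a (k+1)\<close> is the sequence of differences of \<open>a k\<close>, then the partial sums of
\<open>a k\<close> are given by Newton's formula in the initial values \<open>a (k+j) 0\<close>.\<close>

lemma finprod_iterated_differences:
  assumes a: "\<And>k i. a k i \<in> carrier G"
    and step: "\<And>k i. a k (Suc i) = a k i \<otimes> a (Suc k) i"
  shows "finprod G (a k) {..<n} = finprod G (\<lambda>j. a (k + j) 0 [^] (n choose Suc j)) {..<n}"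
proof (induction n arbitrary: k)
  case (Suc n)
  let ?b = "\<lambda>j. a (k + j) 0"
  have "finprod G (a k) {..<Suc n} = a k 0 \<otimes> finprod G (\<lambda>i. a k i \<otimes> a (Suc k) i) {..<n}"
    using a by (simp add: finprod_lessThan_Suc_shift step)
  also have "\<dots> = a k 0 \<otimes> (finprod G (a k) {..<n} \<otimes> finprod G (a (Suc k)) {..<n})"
    using a by (subst finprod_multf) auto
  also have "\<dots> = finprod G (a k) {..<n} \<otimes> (a k 0 \<otimes> finprod G (a (Suc k)) {..<n})"
    using a by (simp add: m_lcomm)
  also have "finprod G (a k) {..<n} = finprod G (\<lambda>j. ?b j [^] (n choose Suc j)) {..<Suc n}"
    using a by (subst finprod_lessThan_Suc) (auto simp: Suc.IH binomial_eq_0)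
  also have "a k 0 \<otimes> finprod G (a (Suc k)) {..<n} = finprod G (\<lambda>j. ?b j [^] (n choose j)) {..<Suc n}"
    using a by (subst finprod_lessThan_Suc_shift) (auto simp: Suc.IH)
  also have "finprod G (\<lambda>j. ?b j [^] (n choose Suc j)) {..<Suc n}
      \<otimes> finprod G (\<lambda>j. ?b j [^] (n choose j)) {..<Suc n}
      = finprod G (\<lambda>j. ?b j [^] (n choose Suc j) \<otimes> ?b j [^] (n choose j)) {..<Suc n}"
    using a by (subst finprod_multf) auto
  also have "\<dots> = finprod G (\<lambda>j. ?b j [^] (Suc n choose Suc j)) {..<Suc n}"
    using a by (intro finprod_cong') (auto simp: nat_pow_mult add.commute)
  finally show ?case .
qed simp

text \<open>The identity \<open>1 + x + ... + x^(p-1) = (x - 1)^(p-1)\<close> modulo \<open>p\<close>: in Newton's formula the binomial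
coefficients \<open>p choose (j+1)\<close> with \<open>j < p - 1\<close> are divisible by \<open>p\<close>, and the term \<open>j = p - 1\<close> vanishes.\<close>

lemma finprod_vanishing_differences:
  assumes p: "Factorial_Ring.prime (p::nat)"
    and a: "\<And>k i. a k i \<in> carrier G"
    and step: "\<And>k i. a k (Suc i) = a k i \<otimes> a (Suc k) i"
    and tors: "\<And>i. a 0 i [^] p = \<one>"
    and van: "a (p - 1) 0 = \<one>"
  shows "finprod G (a 0) {..<p} = \<one>"
proof -
  have tors': "a k i [^] p = \<one>" for k i
  proof (induction k arbitrary: i)
    case (Suc k)
    have "a k (Suc i) [^] p = a k i [^] p \<otimes> a (Suc k) i [^] p"
      using a by (subst step) (simp add: nat_pow_distrib)
    then show ?case using Suc a by simp
  qed (rule tors)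
  have "a (0 + j) 0 [^] (p choose Suc j) = \<one>" if "j \<in> {..<p}" for j
  proof (cases "Suc j = p")
    case True
    then show ?thesis using van by auto
  next
    case False
    then have "p dvd (p choose Suc j)"
      using p that by (intro dvd_choose_prime) auto
    then obtain m where "p choose Suc j = p * m" by blast
    then show ?thesis using tors'[of j 0] a nat_pow_pow[of "a j 0" p m] by simp
  qed
  then have "finprod G (\<lambda>j. a (0 + j) 0 [^] (p choose Suc j)) {..<p} = \<one>"
    by (rule finprod_one_eqI)
  then show ?thesis
    using finprod_iterated_differences[of a 0 p] a step by simp
qed

end

section \<open>The transfer as a product over Sylow subgroups\<close>

text \<open>The set \<open>Syl\<close> of conjugates of \<open>P\<close> replaces the set of cosets of \<open>N\<close> as index set of the
transfer; the element \<open>rep Q\<close> conjugates \<open>P\<close> to \<open>Q\<close> and plays the part of a coset representative.\<close>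

locale sylow_group = group G for G (structure) +
  fixes p :: nat and P :: "'a set"
  assumes fin: "finite (carrier G)"
    and prime_p: "Factorial_Ring.prime p"
    and P_subgroup: "subgroup P G"
    and card_P: "card P = p ^ multiplicity p (order G)"
begin

definition N :: "'a set" where "N = norm_in G (carrier G) P"

definition Syl :: "'a set set" where "Syl = (\<lambda>g. conj_set G g P) ` carrier G"

definition rep :: "'a set \<Rightarrow> 'a" where "rep Q = (SOME g. g \<in> carrier G \<and> conj_set G g P = Q)"

definition cocycle :: "'a set \<Rightarrow> 'a \<Rightarrow> 'a"
  where "cocycle Q g = inv (rep (conj_set G g Q)) \<otimes> g \<otimes> rep Q"

definition at_sylow :: "'a set \<Rightarrow> 'a set \<Rightarrow> 'a set"
  where "at_sylow Z Q = conj_set G (rep Q) Z"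

lemma P_carrier: "P \<subseteq> carrier G"
  using subgroup.subset[OF P_subgroup] .

lemma N_subgroup: "subgroup N G"
  unfolding N_def using subgroup_norm_in[OF subgroup_self P_carrier] .

lemma N_carrier: "N \<subseteq> carrier G"
  using subgroup.subset[OF N_subgroup] .

lemma P_subset_N: "P \<subseteq> N"
  using P_carrier conj_set_self[OF P_subgroup] by (auto simp: N_def norm_in_def)

lemma P_in_Syl: "P \<in> Syl"
  unfolding Syl_def using conj_set_one[OF P_carrier] by (metis image_eqI one_closed)

lemma finite_Syl: "finite Syl"
  using fin by (simp add: Syl_def)

lemma rep:
  assumes "Q \<in> Syl"
  shows rep_closed: "rep Q \<in> carrier G" and conj_rep: "conj_set G (rep Q) P = Q"
proof -
  have "\<exists>g. g \<in> carrier G \<and> conj_set G g P = Q" using assms by (auto simp: Syl_def)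
  from someI_ex[OF this] show "rep Q \<in> carrier G" "conj_set G (rep Q) P = Q"
    by (auto simp: rep_def)
qed

lemma Syl_conj:
  assumes "Q \<in> Syl" "g \<in> carrier G"
  shows "conj_set G g Q \<in> Syl"
proof -
  obtain k where k: "k \<in> carrier G" "Q = conj_set G k P" using assms(1) by (auto simp: Syl_def)
  have "conj_set G g Q = conj_set G (g \<otimes> k) P"
    using conj_set_mult[OF assms(2) k(1) P_carrier] k(2) by simp
  then show ?thesis using assms(2) k(1) by (simp add: Syl_def)
qed

lemma Syl_subgroup: "Q \<in> Syl \<Longrightarrow> subgroup Q G"
  using subgroup_conj_set P_subgroup by (auto simp: Syl_def)

lemma Syl_carrier: "Q \<in> Syl \<Longrightarrow> Q \<subseteq> carrier G"
  by (rule subgroup.subset[OF Syl_subgroup])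

lemma card_Syl_eq: "Q \<in> Syl \<Longrightarrow> card Q = p ^ multiplicity p (order G)"
  using card_conj_set P_carrier card_P by (auto simp: Syl_def)

lemma Syl_finite: "Q \<in> Syl \<Longrightarrow> finite Q"
  using Syl_carrier fin finite_subset by blast

lemma Syl_subset_imp_eq: "Q \<in> Syl \<Longrightarrow> Q' \<in> Syl \<Longrightarrow> Q \<subseteq> Q' \<Longrightarrow> Q = Q'"
  using card_subset_eq[of Q' Q] card_Syl_eq Syl_finite by simp

lemma p_subgroup_normalizing_Syl:
  assumes "Q \<in> Syl" "subgroup H G" "card H = p ^ n" "H \<subseteq> norm_in G (carrier G) Q"
  shows "H \<subseteq> Q"
  using p_subgroup_normalizing_sylow[OF fin prime_p Syl_subgroup card_Syl_eq] assms by blast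

lemma p_element_normalizing_Syl:
  assumes Q: "Q \<in> Syl" and x: "x \<in> carrier G" "ord x = p ^ n" "conj_set G x Q = Q"
  shows "x \<in> Q"
proof -
  let ?H = "generate G {x}"
  have "subgroup ?H G" using x(1) generate_is_subgroup by blast
  moreover have "card ?H = p ^ n" using card_generate_singleton[OF fin x(1)] x(2) by simp
  moreover have "?H \<subseteq> norm_in G (carrier G) Q"
    using subgroup_norm_in[OF subgroup_self Syl_carrier[OF Q]] x
    by (intro generate_subgroup_incl) (auto simp: norm_in_def)
  ultimately have "?H \<subseteq> Q" using p_subgroup_normalizing_Syl[OF Q] by blast
  then show ?thesis using generate.incl[of x "{x}" G] by blast
qed

lemma ord_Syl:
  assumes "Q \<in> Syl" "x \<in> Q"
  obtains k where "ord x = p ^ k"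
proof -
  let ?Q = "G\<lparr>carrier := Q\<rparr>"
  have Q: "subgroup Q G" using Syl_subgroup assms by auto
  interpret Q: group ?Q using subgroup_imp_group[OF Q] .
  have x: "x \<in> carrier G" using Syl_carrier assms by auto
  have "generate G {x} \<subseteq> Q" using assms(2) Q by (intro generate_subgroup_incl) auto
  then have "subgroup (generate G {x}) ?Q"
    using subgroup_in_subgroup[OF generate_is_subgroup Q] x by simp
  then have "card (generate G {x}) dvd card Q"
    using Q.card_subgroup_dvd by (simp add: order_def)
  then have "ord x dvd p ^ multiplicity p (order G)"
    using card_generate_singleton[OF fin x] card_Syl_eq assms by simp
  then show ?thesis using that prime_p by (metis divides_primepow_nat)
qed

text \<open>\<open>P\<close> normalizes no Sylow subgroup other than itself, so \<open>P\<close> moves every member of \<open>X\<close>.\<close>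

lemma p_dvd_card_Syl_moved_by_P:
  assumes "X \<subseteq> Syl" "P \<notin> X" "\<And>h Q. h \<in> P \<Longrightarrow> Q \<in> X \<Longrightarrow> conj_set G h Q \<in> X"
  shows "p dvd card X"
proof -
  have "\<exists>h\<in>P. conj_set G h Q \<noteq> Q" if Q: "Q \<in> X" for Q
  proof (rule ccontr)
    assume "\<not> ?thesis"
    then have "P \<subseteq> norm_in G (carrier G) Q" using P_carrier by (auto simp: norm_in_def)
    then have "P \<subseteq> Q" using p_subgroup_normalizing_Syl[OF _ P_subgroup card_P] Q assms(1) by blast
    then show False using Syl_subset_imp_eq[OF P_in_Syl] Q assms(1,2) by blast
  qed
  then have "{Q \<in> X. \<exists>h\<in>P. conj_set G h Q \<noteq> Q} = X" by blast
  moreover have "p dvd card {Q \<in> X. \<exists>h\<in>P. conj_set G h Q \<noteq> Q}"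
    by (rule p_dvd_card_conj_moved[OF P_subgroup card_P prime_p])
      (use assms finite_Syl Syl_carrier in \<open>(blast dest: finite_subset)+\<close>)
  ultimately show ?thesis by simp
qed

lemma card_Syl_not_dvd: "\<not> p dvd card Syl"
proof -
  have "p dvd card (Syl - {P})"
  proof (rule p_dvd_card_Syl_moved_by_P)
    fix h Q assume h: "h \<in> P" and Q: "Q \<in> Syl - {P}"
    have "conj_set G h Q \<noteq> P"
      using h Q conj_set_inv_cancel(1)[of h Q] conj_set_self[OF P_subgroup, of "inv h"]
        Syl_carrier P_carrier P_subgroup subgroup.m_inv_closed
      by (metis DiffD1 DiffD2 singletonI subsetD)
    then show "conj_set G h Q \<in> Syl - {P}" using h Q P_carrier Syl_conj by auto
  qed auto
  moreover have "card Syl = Suc (card (Syl - {P}))"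
    using card.remove[OF finite_Syl P_in_Syl] .
  ultimately have "p dvd card Syl \<longleftrightarrow> p dvd 1"
    using dvd_add_right_iff[of p "card (Syl - {P})" 1] by simp
  then show ?thesis using prime_p by auto
qed

lemma mem_N_iff: "n \<in> N \<longleftrightarrow> n \<in> carrier G \<and> conj_set G n P = P"
  by (auto simp: N_def norm_in_def)

lemma conj_eq_imp_N:
  assumes "a \<in> carrier G" "b \<in> carrier G" "conj_set G a P = conj_set G b P"
  shows "inv a \<otimes> b \<in> N"
  using assms conj_set_inv_cancel(1)[OF assms(1) P_carrier] P_carrier
  by (simp add: mem_N_iff conj_set_mult)

lemma cocycle_in_N:
  assumes Q: "Q \<in> Syl" and g: "g \<in> carrier G"
  shows "cocycle Q g \<in> N"
proof -
  have "inv (rep (conj_set G g Q)) \<otimes> (g \<otimes> rep Q) \<in> N"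
    using Q g Syl_conj[OF Q g] rep_closed conj_rep P_carrier
    by (intro conj_eq_imp_N) (auto simp: conj_set_mult)
  then show ?thesis
    using Q g Syl_conj[OF Q g] rep_closed by (simp add: cocycle_def m_assoc)
qed

lemma cocycle_mult:
  assumes Q: "Q \<in> Syl" and g: "g \<in> carrier G" and h: "h \<in> carrier G"
  shows "cocycle Q (g \<otimes> h) = cocycle (conj_set G h Q) g \<otimes> cocycle Q h"
proof -
  have "conj_set G (g \<otimes> h) Q = conj_set G g (conj_set G h Q)"
    using conj_set_mult[OF g h Syl_carrier[OF Q]] .
  then show ?thesis
    using Q g h Syl_conj rep_closed by (simp add: cocycle_def m_assoc inv_cancel_left)
qed

lemma finprod_Syl_conj:
  assumes A: "comm_monoid A" and h: "h \<in> carrier G" and f: "f \<in> Syl \<rightarrow> carrier A"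
  shows "finprod A (\<lambda>Q. f (conj_set G h Q)) Syl = finprod A f Syl"
proof -
  have surj: "conj_set G h ` Syl = Syl"
  proof
    show "conj_set G h ` Syl \<subseteq> Syl" using h Syl_conj by auto
    show "Syl \<subseteq> conj_set G h ` Syl"
    proof
      fix Q assume Q: "Q \<in> Syl"
      then have "Q = conj_set G h (conj_set G (inv h) Q)"
        using conj_set_inv_cancel(2)[OF h Syl_carrier] by simp
      then show "Q \<in> conj_set G h ` Syl" using Syl_conj[OF Q, of "inv h"] h by blast
    qed
  qed
  have "inj_on (conj_set G h) Syl"
    by (rule inj_on_inverseI[where g = "conj_set G (inv h)"])
      (use h Syl_carrier conj_set_inv_cancel(1) in auto)
  then have "finprod A f (conj_set G h ` Syl) = finprod A (\<lambda>Q. f (conj_set G h Q)) Syl"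
    using f surj by (intro comm_monoid.finprod_reindex[OF A]) auto
  then show ?thesis using surj by simp
qed

text \<open>The transfer of a restriction to \<open>N\<close> is a power: the contributions of the representatives to the
cocycle differ by a permutation of \<open>Syl\<close> and cancel.\<close>

lemma finprod_hom_cocycle:
  assumes A: "comm_group A" and phi: "phi \<in> hom G A" and g: "g \<in> carrier G"
  shows "finprod A (\<lambda>Q. phi (cocycle Q g)) Syl = phi g [^]\<^bsub>A\<^esub> card Syl"
proof -
  interpret A: comm_group A by (rule A)
  interpret phi: group_hom G A phi
    using phi by (simp add: group_hom_def group_hom_axioms_def is_group A.is_group)
  let ?s = "\<lambda>Q. phi (rep Q)"
  have s: "?s \<in> Syl \<rightarrow> carrier A" using rep_closed by auto
  have sg: "(\<lambda>Q. ?s (conj_set G g Q)) \<in> Syl \<rightarrow> carrier A" using rep_closed Syl_conj g by auto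
  have c: "(\<lambda>Q. phi (cocycle Q g)) \<in> Syl \<rightarrow> carrier A"
    using cocycle_in_N[OF _ g] N_carrier by (auto intro!: phi.hom_closed)
  have "?s (conj_set G g Q) \<otimes>\<^bsub>A\<^esub> phi (cocycle Q g) = phi g \<otimes>\<^bsub>A\<^esub> ?s Q" if Q: "Q \<in> Syl" for Q
  proof -
    have r: "rep (conj_set G g Q) \<in> carrier G" "rep Q \<in> carrier G" "cocycle Q g \<in> carrier G"
      using Q g Syl_conj rep_closed cocycle_in_N N_carrier by auto
    then have "rep (conj_set G g Q) \<otimes> cocycle Q g = g \<otimes> rep Q"
      using g by (simp add: cocycle_def m_assoc inv_cancel_left)
    then show ?thesis using phi.hom_mult[OF r(1,3)] phi.hom_mult[OF g r(2)] by simp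
  qed
  then have "finprod A (\<lambda>Q. ?s (conj_set G g Q) \<otimes>\<^bsub>A\<^esub> phi (cocycle Q g)) Syl
      = finprod A (\<lambda>Q. phi g \<otimes>\<^bsub>A\<^esub> ?s Q) Syl"
    using s g by (intro A.finprod_cong') auto
  then have "finprod A ?s Syl \<otimes>\<^bsub>A\<^esub> finprod A (\<lambda>Q. phi (cocycle Q g)) Syl
      = phi g [^]\<^bsub>A\<^esub> card Syl \<otimes>\<^bsub>A\<^esub> finprod A ?s Syl"
    using A.finprod_multf[OF sg c] A.finprod_multf[of "\<lambda>Q. phi g" Syl ?s] A.finprod_const[of "phi g" Syl]
      finprod_Syl_conj[OF A.comm_monoid_axioms g s] s g by simp
  also have "\<dots> = finprod A ?s Syl \<otimes>\<^bsub>A\<^esub> phi g [^]\<^bsub>A\<^esub> card Syl"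
    using A.finprod_closed[OF s] g by (intro A.m_comm) auto
  finally show ?thesis
    using A.finprod_closed[OF s] A.finprod_closed[OF c] g by simp
qed

lemma rep_P_in_N: "rep P \<in> N"
  using rep_closed[OF P_in_Syl] conj_rep[OF P_in_Syl] by (simp add: mem_N_iff)

lemma at_sylow_P:
  assumes "\<And>n. n \<in> N \<Longrightarrow> conj_set G n Z = Z"
  shows "at_sylow Z P = Z"
  using assms rep_P_in_N by (simp add: at_sylow_def)

text \<open>The family \<open>at_sylow Z\<close> is the copy of \<open>Z\<close> inside each Sylow subgroup. Invariance of \<open>Z\<close> under \<open>N\<close>
makes the copies independent of representatives, hence compatible with conjugation.\<close>

lemma conj_at_sylow:
  assumes Z: "Z \<subseteq> carrier G" "\<And>n. n \<in> N \<Longrightarrow> conj_set G n Z = Z"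
    and Q: "Q \<in> Syl" and g: "g \<in> carrier G"
  shows "conj_set G g (at_sylow Z Q) = at_sylow Z (conj_set G g Q)"
proof -
  let ?r = "rep (conj_set G g Q)"
  have r: "?r \<in> carrier G" "rep Q \<in> carrier G" using Syl_conj[OF Q g] rep_closed Q by auto
  have "g \<otimes> rep Q = ?r \<otimes> cocycle Q g"
    using r g by (simp add: cocycle_def m_assoc inv_cancel_left)
  then have "conj_set G g (at_sylow Z Q) = conj_set G (?r \<otimes> cocycle Q g) Z"
    using conj_set_mult[OF g r(2) Z(1)] by (simp add: at_sylow_def)
  also have "\<dots> = conj_set G ?r (conj_set G (cocycle Q g) Z)"
    using r cocycle_in_N[OF Q g] N_carrier Z(1) by (intro conj_set_mult) auto
  finally show ?thesis using Z(2) cocycle_in_N[OF Q g] by (simp add: at_sylow_def)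
qed

lemma mem_norm_Syl: "Q \<in> Syl \<Longrightarrow> x \<in> Q \<Longrightarrow> x \<in> norm_in G (carrier G) Q"
  using Syl_carrier conj_set_self[OF Syl_subgroup] by (auto simp: norm_in_def)

end

text \<open>The map \<open>lam_at Q\<close> transports \<open>lam\<close> to \<open>N_G(Q)\<close> along \<open>rep Q\<close>. As \<open>A\<close> is abelian, the result is
independent of the choice of \<open>rep Q\<close>.\<close>

locale sylow_transfer = sylow_group G p P + A: comm_group A
  for G (structure) and p P and A (structure) +
  fixes lam :: "'a \<Rightarrow> 'c"
  assumes lam_hom: "lam \<in> hom (G\<lparr>carrier := sylow_group.N G P\<rparr>) A"
begin

definition transfer :: "'a \<Rightarrow> 'c"
  where "transfer g = finprod A (\<lambda>Q. lam (cocycle Q g)) Syl"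

definition lam_at :: "'a set \<Rightarrow> 'a \<Rightarrow> 'c"
  where "lam_at Q x = lam (inv (rep Q) \<otimes> x \<otimes> rep Q)"

lemma lam_closed: "n \<in> N \<Longrightarrow> lam n \<in> carrier A"
  using lam_hom by (auto simp: hom_def)

lemma lam_mult: "m \<in> N \<Longrightarrow> n \<in> N \<Longrightarrow> lam (m \<otimes> n) = lam m \<otimes>\<^bsub>A\<^esub> lam n"
  using lam_hom by (auto simp: hom_def)

lemma N_group_hom: "group_hom (G\<lparr>carrier := N\<rparr>) A lam"
  using subgroup_imp_group[OF N_subgroup] A.is_group lam_hom
  by (simp add: group_hom_def group_hom_axioms_def)

lemma lam_one: "lam \<one> = \<one>\<^bsub>A\<^esub>"
  using group_hom.hom_one[OF N_group_hom] by simp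

lemma lam_conj:
  assumes m: "m \<in> N" and n: "n \<in> N"
  shows "lam (m \<otimes> n \<otimes> inv m) = lam n"
proof -
  have im: "inv m \<in> N" using subgroup.m_inv_closed[OF N_subgroup m] .
  have mG: "m \<in> carrier G" using m N_carrier by auto
  have "lam (m \<otimes> n \<otimes> inv m) = lam m \<otimes>\<^bsub>A\<^esub> lam n \<otimes>\<^bsub>A\<^esub> lam (inv m)"
    using m n im subgroup.m_closed[OF N_subgroup] by (simp add: lam_mult)
  also have "\<dots> = lam n \<otimes>\<^bsub>A\<^esub> (lam m \<otimes>\<^bsub>A\<^esub> lam (inv m))"
    using A.m_assoc A.m_comm[of "lam m" "lam n"] lam_closed[OF m] lam_closed[OF n] lam_closed[OF im]
    by simp
  also have "lam m \<otimes>\<^bsub>A\<^esub> lam (inv m) = \<one>\<^bsub>A\<^esub>"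
    using lam_mult[OF m im] lam_one mG by simp
  finally show ?thesis using lam_closed n by simp
qed

lemma transfer_hom: "transfer \<in> hom G A"
proof (rule homI)
  fix g h assume g: "g \<in> carrier G" and h: "h \<in> carrier G"
  have cl: "(\<lambda>Q. lam (cocycle Q g)) \<in> Syl \<rightarrow> carrier A" if "g \<in> carrier G" for g
    using that cocycle_in_N lam_closed by auto
  have cl': "(\<lambda>Q. lam (cocycle (conj_set G h Q) g)) \<in> Syl \<rightarrow> carrier A"
    using g h cocycle_in_N lam_closed Syl_conj by auto
  have "transfer (g \<otimes> h) = finprod A (\<lambda>Q. lam (cocycle (conj_set G h Q) g) \<otimes>\<^bsub>A\<^esub> lam (cocycle Q h)) Syl"
    unfolding transfer_def using g h cl cl'
    by (intro A.finprod_cong') (auto simp: cocycle_mult lam_mult cocycle_in_N Syl_conj Pi_iff)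
  also have "\<dots> = finprod A (\<lambda>Q. lam (cocycle (conj_set G h Q) g)) Syl \<otimes>\<^bsub>A\<^esub> transfer h"
    unfolding transfer_def using cl[OF h] cl' by (rule A.finprod_multf[rotated])
  also have "finprod A (\<lambda>Q. lam (cocycle (conj_set G h Q) g)) Syl = transfer g"
    unfolding transfer_def using A.comm_monoid_axioms h cl[OF g] by (rule finprod_Syl_conj)
  finally show "transfer (g \<otimes> h) = transfer g \<otimes>\<^bsub>A\<^esub> transfer h" .
next
  fix g assume "g \<in> carrier G"
  then show "transfer g \<in> carrier A"
    unfolding transfer_def using cocycle_in_N lam_closed by (intro A.finprod_closed) auto
qed

lemma norm_conj_rep_in_N:
  assumes Q: "Q \<in> Syl" and x: "x \<in> norm_in G (carrier G) Q"
  shows "inv (rep Q) \<otimes> x \<otimes> rep Q \<in> N"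
proof -
  have "x \<in> carrier G" "conj_set G x Q = Q" using x by (auto simp: norm_in_def)
  then show ?thesis using cocycle_in_N[OF Q, of x] by (simp add: cocycle_def)
qed

lemma lam_at_closed: "Q \<in> Syl \<Longrightarrow> x \<in> norm_in G (carrier G) Q \<Longrightarrow> lam_at Q x \<in> carrier A"
  unfolding lam_at_def using norm_conj_rep_in_N lam_closed by blast

lemma lam_at_mult:
  assumes Q: "Q \<in> Syl" and x: "x \<in> norm_in G (carrier G) Q" and y: "y \<in> norm_in G (carrier G) Q"
  shows "lam_at Q (x \<otimes> y) = lam_at Q x \<otimes>\<^bsub>A\<^esub> lam_at Q y"
proof -
  have "x \<in> carrier G" "y \<in> carrier G" using x y by (auto simp: norm_in_def)
  then have "inv (rep Q) \<otimes> (x \<otimes> y) \<otimes> rep Q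
      = (inv (rep Q) \<otimes> x \<otimes> rep Q) \<otimes> (inv (rep Q) \<otimes> y \<otimes> rep Q)"
    using rep_closed[OF Q] conj_mult[of "inv (rep Q)" x y] by simp
  then show ?thesis
    unfolding lam_at_def using lam_mult norm_conj_rep_in_N assms by simp
qed

lemma lam_at_conj:
  assumes Q: "Q \<in> Syl" and x: "x \<in> norm_in G (carrier G) Q" and g: "g \<in> carrier G"
  shows "lam_at (conj_set G g Q) (g \<otimes> x \<otimes> inv g) = lam_at Q x"
proof -
  let ?r = "rep (conj_set G g Q)" and ?n = "cocycle Q g"
  have xG: "x \<in> carrier G" using x by (auto simp: norm_in_def)
  have r: "?r \<in> carrier G" "rep Q \<in> carrier G" using Syl_conj[OF Q g] rep_closed Q by auto
  have "inv ?r \<otimes> (g \<otimes> x \<otimes> inv g) \<otimes> ?r = ?n \<otimes> (inv (rep Q) \<otimes> x \<otimes> rep Q) \<otimes> inv ?n"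
    using r g xG by (simp add: cocycle_def m_assoc inv_mult_group inv_cancel_left)
  then show ?thesis
    unfolding lam_at_def using lam_conj cocycle_in_N[OF Q g] norm_conj_rep_in_N[OF Q x] by simp
qed

lemma lam_at_P:
  assumes "x \<in> N"
  shows "lam_at P x = lam x"
proof -
  have "inv (rep P) \<in> N" using subgroup.m_inv_closed[OF N_subgroup rep_P_in_N] .
  then show ?thesis
    unfolding lam_at_def using lam_conj[of "inv (rep P)" x] assms rep_P_in_N N_carrier by auto
qed

end

section \<open>Transfer of an element of minimal order\<close>

context group
begin

lemma conj_pow:
  assumes "g \<in> carrier G" "x \<in> carrier G"
  shows "(g \<otimes> x \<otimes> inv g) [^] (n::nat) = g \<otimes> x [^] n \<otimes> inv g"
proof (induction n)
  case (Suc n)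
  then show ?case using conj_mult[OF assms(1) nat_pow_closed[OF assms(2), of n] assms(2)] by simp
qed (use assms in simp)

lemma ord_conj:
  assumes "g \<in> carrier G" "x \<in> carrier G"
  shows "ord (g \<otimes> x \<otimes> inv g) = ord x"
proof -
  have "(g \<otimes> x \<otimes> inv g) [^] n = \<one> \<longleftrightarrow> x [^] n = \<one>" for n :: nat
  proof -
    have "g \<otimes> x [^] n \<otimes> inv g = \<one> \<longleftrightarrow> x [^] n = \<one>"
    proof
      assume "g \<otimes> x [^] n \<otimes> inv g = \<one>"
      then show "x [^] n = \<one>" using assms conj_cancel(1)[of g "x [^] n"] by simp
    qed (use assms in simp)
    then show ?thesis using assms by (simp add: conj_pow)
  qed
  then have "ord (g \<otimes> x \<otimes> inv g) dvd n \<longleftrightarrow> ord x dvd n" for n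
    using assms by (simp flip: pow_eq_id)
  then show ?thesis by (meson dvd_antisym dvd_refl)
qed

lemma funpow_conj_set:
  assumes "g \<in> carrier G" "S \<subseteq> carrier G"
  shows "(conj_set G g ^^ n) S = conj_set G (g [^] n) S"
proof (induction n)
  case (Suc n)
  have "conj_set G (g [^] Suc n) S = conj_set G (g \<otimes> g [^] n) S"
    using assms nat_pow_Suc2 by simp
  then show ?case using Suc assms conj_set_mult[of g "g [^] n" S] by simp
qed (use assms conj_set_one in simp)

end

lemma (in comm_monoid) finprod_split:
  assumes "finite X" "g \<in> X \<rightarrow> carrier G"
  shows "finprod G g X = finprod G g {x \<in> X. Q x} \<otimes> finprod G g {x \<in> X. \<not> Q x}"
proof -
  have "finprod G g ({x \<in> X. Q x} \<union> {x \<in> X. \<not> Q x})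
      = finprod G g {x \<in> X. Q x} \<otimes> finprod G g {x \<in> X. \<not> Q x}"
    using assms by (intro finprod_Un_disjoint) auto
  moreover have "{x \<in> X. Q x} \<union> {x \<in> X. \<not> Q x} = X" by auto
  ultimately show ?thesis by simp
qed

context sylow_transfer
begin

lemma Syl_pow_closed:
  assumes "Q \<in> Syl" "x \<in> Q"
  shows "x [^] (n::nat) \<in> Q"
  using assms(2) subgroup.one_closed[OF Syl_subgroup[OF assms(1)]]
    subgroup.m_closed[OF Syl_subgroup[OF assms(1)]]
  by (induction n) auto

lemma lam_at_one: "Q \<in> Syl \<Longrightarrow> lam_at Q \<one> = \<one>\<^bsub>A\<^esub>"
  using rep_closed lam_one by (simp add: lam_at_def)

lemma lam_at_pow:
  assumes Q: "Q \<in> Syl" and x: "x \<in> Q"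
  shows "lam_at Q (x [^] n) = lam_at Q x [^]\<^bsub>A\<^esub> (n::nat)"
proof (induction n)
  case (Suc n)
  have "x [^] n \<in> Q" using Syl_pow_closed[OF Q x] .
  then show ?case
    using Suc lam_at_mult[OF Q mem_norm_Syl[OF Q] mem_norm_Syl[OF Q x]] by simp
qed (simp add: lam_at_one[OF Q])

text \<open>By the cocycle identity the product along an orbit of \<open>u\<close> telescopes.\<close>

lemma finprod_cocycle_powers:
  assumes Q: "Q \<in> Syl" and u: "u \<in> carrier G"
  shows "finprod A (\<lambda>i. lam (cocycle (conj_set G (u [^] i) Q) u)) {..<n} = lam (cocycle Q (u [^] (n::nat)))"
proof (induction n)
  case 0
  have "conj_set G \<one> Q = Q" using conj_set_one Syl_carrier[OF Q] by blast
  then show ?case using rep_closed[OF Q] lam_one by (simp add: cocycle_def)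
next
  case (Suc n)
  have cl: "lam (cocycle (conj_set G (u [^] i) Q) u) \<in> carrier A" for i :: nat
    using Q u Syl_conj cocycle_in_N lam_closed by simp
  have "cocycle Q (u [^] Suc n) = cocycle (conj_set G (u [^] n) Q) u \<otimes> cocycle Q (u [^] n)"
    using cocycle_mult[OF Q u, of "u [^] n"] u nat_pow_Suc2 by simp
  then have "lam (cocycle Q (u [^] Suc n))
      = lam (cocycle (conj_set G (u [^] n) Q) u) \<otimes>\<^bsub>A\<^esub> lam (cocycle Q (u [^] n))"
    using lam_mult[OF cocycle_in_N[OF Syl_conj[OF Q] u] cocycle_in_N[OF Q]] u by simp
  then show ?case using Suc cl by (subst A.finprod_lessThan_Suc) auto
qed

end

text \<open>The situation of an element \<open>u\<close> of minimal order outside the kernel of \<open>lam\<close>: all conjugates of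
proper powers \<open>u^n\<close>, with \<open>n > 1\<close> a divisor of the order of \<open>u\<close>, have smaller order and disappear
under \<open>lam\<close>.\<close>

locale minimal_element = sylow_transfer +
  fixes u
  assumes u_closed: "u \<in> carrier G"
    and ord_u: "\<exists>k. ord u = p ^ k"
    and u_not_one: "u \<noteq> \<one>"
    and small: "\<And>y. y \<in> N \<Longrightarrow> ord y < ord u \<Longrightarrow> lam y = \<one>\<^bsub>A\<^esub>"
begin

lemma p_dvd_ord_u: "p dvd ord u"
proof -
  obtain k where k: "ord u = p ^ k" using ord_u by blast
  have "k \<noteq> 0" using k u_not_one u_closed ord_eq_1 by (metis power_0)
  then show ?thesis using k by (simp add: dvd_power)
qed

lemma ord_u_pos: "ord u > 0"
  using ord_ge_1[OF fin u_closed] by simp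

lemma ord_power_less:
  assumes "n dvd ord u" "n > 1"
  shows "ord (u [^] n) < ord u"
proof -
  have "ord (u [^] n) = ord u div n"
    using ord_pow_gen[OF u_closed, of n] assms by (simp add: gcd_proj2_if_dvd)
  then show ?thesis using assms ord_u_pos by simp
qed

lemma lam_at_small:
  assumes Q: "Q \<in> Syl" and y: "y \<in> norm_in G (carrier G) Q" and o: "ord y < ord u"
  shows "lam_at Q y = \<one>\<^bsub>A\<^esub>"
proof -
  have yG: "y \<in> carrier G" using y by (auto simp: norm_in_def)
  have "ord (inv (rep Q) \<otimes> y \<otimes> rep Q) = ord y"
    using ord_conj[of "inv (rep Q)" y] rep_closed[OF Q] yG by simp
  then show ?thesis unfolding lam_at_def using small norm_conj_rep_in_N[OF Q y] o by simp
qed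

lemma u_normalizes_iff: "Q \<in> Syl \<Longrightarrow> conj_set G u Q = Q \<longleftrightarrow> u \<in> Q"
  using p_element_normalizing_Syl[of Q u] u_closed ord_u conj_set_self[OF Syl_subgroup] by blast

text \<open>An orbit of length \<open>n > 1\<close> through \<open>Q\<close> contributes \<open>lam_at Q (u^n)\<close>, and \<open>u^n\<close> has smaller order
than \<open>u\<close>. A \<open>p\<close>-element that normalizes \<open>Q\<close> lies in \<open>Q\<close>, so the fixed points are the Sylow
subgroups containing \<open>u\<close>.\<close>

lemma transfer_eq_finprod_containing:
  "transfer u = finprod A (\<lambda>Q. lam_at Q u) {Q \<in> Syl. u \<in> Q}"
proof -
  have cl: "(\<lambda>Q. lam (cocycle Q u)) \<in> Syl \<rightarrow> carrier A"
    using u_closed cocycle_in_N lam_closed by auto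
  let ?X = "{Q \<in> Syl. \<not> u \<in> Q}"
  have "finprod A (\<lambda>Q. lam (cocycle Q u)) ?X = \<one>\<^bsub>A\<^esub>"
  proof (rule A.finprod_orbits_eq_one[where f = "conj_set G u"])
    show "finite ?X" using finite_Syl by simp
    show "conj_set G u \<in> ?X \<rightarrow> ?X"
    proof
      fix Q assume Q: "Q \<in> ?X"
      have "inv u \<otimes> u \<otimes> u = u" using u_closed by simp
      then show "conj_set G u Q \<in> ?X"
        using Q Syl_conj u_closed mem_conj_set[of u Q u] Syl_carrier by auto
    qed
    show "inj_on (conj_set G u) ?X"
      by (rule inj_on_inverseI[where g = "conj_set G (inv u)"])
        (use u_closed Syl_carrier conj_set_inv_cancel(1) in auto)
    show "(\<lambda>Q. lam (cocycle Q u)) \<in> ?X \<rightarrow> carrier A" using cl by auto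
  next
    fix Q n assume Q: "Q \<in> ?X" and n: "0 < n" "(conj_set G u ^^ n) Q = Q"
      and inj: "inj_on (\<lambda>i. (conj_set G u ^^ i) Q) {..<n}"
    have QS: "Q \<in> Syl" and QG: "Q \<subseteq> carrier G" using Q Syl_carrier by auto
    note fp = funpow_conj_set[OF u_closed QG]
    have "(conj_set G u ^^ ord u) Q = Q"
      using fp conj_set_one[OF QG] pow_ord_eq_1[OF u_closed] by simp
    then have "(conj_set G u ^^ (ord u mod n)) Q = Q"
      using n(2) by (metis funpow_mod_eq)
    then have "ord u mod n = 0"
      using n(1) inj_onD[OF inj, of "ord u mod n" 0] by simp
    then have "n dvd ord u" by (simp add: dvd_eq_mod_eq_0)
    moreover have "n \<noteq> 1"
    proof
      assume "n = 1"
      then have "conj_set G u Q = Q" using n(2) by simp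
      then show False using Q u_normalizes_iff[OF QS] by blast
    qed
    ultimately have less: "ord (u [^] n) < ord u" using ord_power_less n(1) by simp
    have fix_n: "conj_set G (u [^] n) Q = Q" using n(2) fp by simp
    then have "cocycle Q (u [^] n) = inv (rep Q) \<otimes> u [^] n \<otimes> rep Q" by (simp add: cocycle_def)
    then have "lam (cocycle Q (u [^] n)) = lam_at Q (u [^] n)" by (simp add: lam_at_def)
    also have "\<dots> = \<one>\<^bsub>A\<^esub>"
      using fix_n u_closed less by (intro lam_at_small QS) (auto simp: norm_in_def)
    finally show "finprod A (\<lambda>i. lam (cocycle ((conj_set G u ^^ i) Q) u)) {..<n} = \<one>\<^bsub>A\<^esub>"
      using finprod_cocycle_powers[OF QS u_closed, of n] fp by simp
  qed
  moreover have "finprod A (\<lambda>Q. lam (cocycle Q u)) {Q \<in> Syl. u \<in> Q}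
      = finprod A (\<lambda>Q. lam_at Q u) {Q \<in> Syl. u \<in> Q}"
  proof (rule A.finprod_cong')
    fix Q assume "Q \<in> {Q \<in> Syl. u \<in> Q}"
    then show "lam (cocycle Q u) = lam_at Q u"
      using u_normalizes_iff[of Q] by (simp add: cocycle_def lam_at_def)
  qed (use lam_at_closed mem_norm_Syl in auto)
  moreover have "finprod A (\<lambda>Q. lam_at Q u) {Q \<in> Syl. u \<in> Q} \<in> carrier A"
    using lam_at_closed mem_norm_Syl by (intro A.finprod_closed) auto
  ultimately show ?thesis
    unfolding transfer_def using A.finprod_split[OF finite_Syl cl, of "\<lambda>Q. u \<in> Q"] by simp
qed

text \<open>The iterated commutators \<open>[u, x, ..., x]\<close> in the form \<open>c^-1 (x c x^-1)\<close>, so that they are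
the initial values of the successive differences of the sequence of conjugates \<open>x^i u x^-i\<close>.\<close>

definition iter_comm :: "'a \<Rightarrow> nat \<Rightarrow> 'a"
  where "iter_comm x k = ((\<lambda>c. inv c \<otimes> (x \<otimes> c \<otimes> inv x)) ^^ k) u"

lemma iter_comm_0 [simp]: "iter_comm x 0 = u"
  by (simp add: iter_comm_def)

lemma iter_comm_Suc:
  "iter_comm x (Suc k) = inv (iter_comm x k) \<otimes> (x \<otimes> iter_comm x k \<otimes> inv x)"
  by (simp add: iter_comm_def)

text \<open>Conjugating back to \<open>Q\<close> turns the \<open>i\<close>-th factor into \<open>lam_at Q (x^i u x^-i)\<close>. Its \<open>p\<close>-th power is the
value at a conjugate of \<open>u^p\<close>, which is trivial because \<open>u^p\<close> has smaller order than \<open>u\<close>.\<close>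

lemma finprod_conj_block:
  assumes Q: "Q \<in> Syl" and x: "x \<in> carrier G"
    and mem: "\<And>k i::nat. x [^] i \<otimes> iter_comm x k \<otimes> inv (x [^] i) \<in> Q"
    and van: "iter_comm x (p - 1) = \<one>"
  shows "finprod A (\<lambda>i. lam_at ((conj_set G (inv x) ^^ i) Q) u) {..<p} = \<one>\<^bsub>A\<^esub>"
proof -
  let ?c = "iter_comm x"
  let ?a = "\<lambda>k i. lam_at Q (x [^] i \<otimes> ?c k \<otimes> inv (x [^] (i::nat)))"
  have QG: "Q \<subseteq> carrier G" using Syl_carrier[OF Q] .
  have cG: "?c k \<in> carrier G" for k using x u_closed by (induction k) (auto simp: iter_comm_Suc)
  have norm: "x [^] i \<otimes> ?c k \<otimes> inv (x [^] i) \<in> norm_in G (carrier G) Q" for k and i :: nat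
    using mem mem_norm_Syl[OF Q] by blast
  have "finprod A (?a 0) {..<p} = \<one>\<^bsub>A\<^esub>"
  proof (rule A.finprod_vanishing_differences[OF prime_p])
    show "?a k i \<in> carrier A" for k i using lam_at_closed[OF Q norm] .
    show "?a k (Suc i) = ?a k i \<otimes>\<^bsub>A\<^esub> ?a (Suc k) i" for k i
    proof -
      let ?y = "x [^] i"
      have y: "?y \<in> carrier G" using x by simp
      have "x [^] Suc i \<otimes> ?c k \<otimes> inv (x [^] Suc i) = ?y \<otimes> (x \<otimes> ?c k \<otimes> inv x) \<otimes> inv ?y"
        using x y cG[of k] by (simp add: m_assoc inv_mult_group)
      also have "x \<otimes> ?c k \<otimes> inv x = ?c k \<otimes> ?c (Suc k)"
        using x cG[of k] by (simp add: inv_cancel_left iter_comm_Suc)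
      also have "?y \<otimes> (?c k \<otimes> ?c (Suc k)) \<otimes> inv ?y
          = (?y \<otimes> ?c k \<otimes> inv ?y) \<otimes> (?y \<otimes> ?c (Suc k) \<otimes> inv ?y)"
        using y cG[of k] cG[of "Suc k"] by (rule conj_mult)
      finally show ?thesis using lam_at_mult[OF Q norm norm] by simp
    qed
    show "?a 0 i [^]\<^bsub>A\<^esub> p = \<one>\<^bsub>A\<^esub>" for i
    proof -
      let ?w = "x [^] i \<otimes> u \<otimes> inv (x [^] i)"
      have w: "?w \<in> Q" using mem[of i 0] by simp
      have "ord (?w [^] p) = ord (u [^] p)"
        using x u_closed by (simp add: conj_pow ord_conj)
      then have "ord (?w [^] p) < ord u"
        using ord_power_less[OF p_dvd_ord_u prime_gt_1_nat[OF prime_p]] by simp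
      moreover have "?w [^] p \<in> Q"
        using Syl_pow_closed[OF Q w] .
      ultimately have "lam_at Q (?w [^] p) = \<one>\<^bsub>A\<^esub>"
        using lam_at_small[OF Q] mem_norm_Syl[OF Q] by blast
      then show ?thesis using lam_at_pow[OF Q w, of p] by simp
    qed
    show "?a (p - 1) 0 = \<one>\<^bsub>A\<^esub>" using van lam_at_one[OF Q] by simp
  qed
  moreover have "lam_at ((conj_set G (inv x) ^^ i) Q) u = ?a 0 i" for i
  proof -
    let ?y = "x [^] i"
    have y: "?y \<in> carrier G" using x by simp
    have "(conj_set G (inv x) ^^ i) Q = conj_set G (inv ?y) Q"
      using funpow_conj_set[OF inv_closed[OF x] QG] x nat_pow_inv by simp
    moreover have "inv ?y \<otimes> (?y \<otimes> u \<otimes> inv ?y) \<otimes> inv (inv ?y) = u"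
      using conj_cancel(1)[OF y u_closed] y by simp
    moreover have "?y \<otimes> u \<otimes> inv ?y \<in> norm_in G (carrier G) Q" using norm[of i 0] by simp
    ultimately show ?thesis using lam_at_conj[OF Q _ inv_closed[OF y], of "?y \<otimes> u \<otimes> inv ?y"] by simp
  qed
  ultimately show ?thesis by simp
qed

text \<open>The powers of \<open>x\<close> permute the family in blocks of exactly \<open>p\<close> Sylow subgroups, since \<open>x^p\<close> normalizes
every \<open>Q\<close> in it while \<open>x\<close>, a \<open>p\<close>-element outside \<open>Q\<close>, does not.\<close>

lemma finprod_conj_family:
  assumes X: "X \<subseteq> Syl" and x: "x \<in> P"
    and closed: "\<And>Q. Q \<in> X \<Longrightarrow> conj_set G (inv x) Q \<in> X"
    and x_notin: "\<And>Q. Q \<in> X \<Longrightarrow> x \<notin> Q" and x_pow: "\<And>Q. Q \<in> X \<Longrightarrow> x [^] p \<in> Q"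
    and mem: "\<And>Q k (i::nat). Q \<in> X \<Longrightarrow> x [^] i \<otimes> iter_comm x k \<otimes> inv (x [^] i) \<in> Q"
    and van: "iter_comm x (p - 1) = \<one>"
  shows "finprod A (\<lambda>Q. lam_at Q u) X = \<one>\<^bsub>A\<^esub>"
proof (rule A.finprod_blocks_eq_one[OF prime_p, where f = "conj_set G (inv x)"])
  have xG: "x \<in> carrier G" using x P_carrier by auto
  show "finite X" using X finite_Syl finite_subset by blast
  show "conj_set G (inv x) \<in> X \<rightarrow> X" using closed by auto
  show "inj_on (conj_set G (inv x)) X"
    by (rule inj_on_inverseI[where g = "conj_set G x"])
      (use X xG Syl_carrier conj_set_inv_cancel(2) in auto)
  show "(\<lambda>Q. lam_at Q u) \<in> X \<rightarrow> carrier A"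
  proof
    fix Q assume Q: "Q \<in> X"
    then have "u \<in> Q" using mem[OF Q, of 0 0] xG u_closed by simp
    then show "lam_at Q u \<in> carrier A" using lam_at_closed mem_norm_Syl Q X by blast
  qed
  fix Q assume Q: "Q \<in> X"
  then have QS: "Q \<in> Syl" and QG: "Q \<subseteq> carrier G" using X Syl_carrier by auto
  have "(conj_set G (inv x) ^^ p) Q = conj_set G (inv (x [^] p)) Q"
    using funpow_conj_set[OF inv_closed[OF xG] QG] xG nat_pow_inv by simp
  also have "\<dots> = Q"
    using conj_set_self[OF Syl_subgroup[OF QS]] subgroup.m_inv_closed[OF Syl_subgroup[OF QS]] x_pow[OF Q]
    by blast
  finally show "(conj_set G (inv x) ^^ p) Q = Q" .
  show "conj_set G (inv x) Q \<noteq> Q"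
  proof
    assume "conj_set G (inv x) Q = Q"
    then have "conj_set G x Q = Q" using conj_set_inv_cancel(2)[OF xG QG] by simp
    moreover obtain k where "ord x = p ^ k" using ord_Syl[OF P_in_Syl x] .
    ultimately have "x \<in> Q" using p_element_normalizing_Syl[OF QS xG] by blast
    then show False using x_notin[OF Q] by simp
  qed
  show "finprod A (\<lambda>i. lam_at ((conj_set G (inv x) ^^ i) Q) u) {..<p} = \<one>\<^bsub>A\<^esub>"
    using finprod_conj_block[OF QS xG mem[OF Q] van] .
qed

end

section \<open>Fusion in intersections above Z\<close>

text \<open>For \<open>Z = Z_(p-1)(P)\<close> the assumption \<open>tame_conj\<close> is what the \<open>p\<close>-nilpotency of normalizers of tame
intersections is used for: the two normalizers of \<open>P \<inter> Q\<close> are conjugate by an element centralizing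
\<open>P \<inter> Q\<close>. Tameness is expressed by the orders of these normalizers.\<close>

locale tame_centralizer_fusion = sylow_group +
  fixes Z
  assumes Z_subset_P: "Z \<subseteq> P"
    and N_fixes_Z: "\<And>n. n \<in> N \<Longrightarrow> conj_set G n Z = Z"
    and tame_conj: "\<And>Q. Q \<in> Syl \<Longrightarrow>
      card (norm_in G P (P \<inter> Q)) = p ^ multiplicity p (card (norm_in G (carrier G) (P \<inter> Q))) \<Longrightarrow>
      card (norm_in G Q (P \<inter> Q)) = p ^ multiplicity p (card (norm_in G (carrier G) (P \<inter> Q))) \<Longrightarrow>
      Z \<subset> P \<inter> Q \<Longrightarrow> P \<inter> Q \<subset> P \<Longrightarrow>
      \<exists>c\<in>carrier G. (\<forall>x\<in>P \<inter> Q. c \<otimes> x \<otimes> inv c = x)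
        \<and> conj_set G c (norm_in G P (P \<inter> Q)) = norm_in G Q (P \<inter> Q)"
begin

lemma Z_carrier: "Z \<subseteq> carrier G"
  using Z_subset_P P_carrier by auto

text \<open>Conjugation by \<open>(rep U)^-1\<close> moves \<open>U\<close> to \<open>P\<close>, so the assumption made for intersections with \<open>P\<close> holds
for all pairs of Sylow subgroups.\<close>

lemma tame_conj_general:
  assumes U: "U \<in> Syl" and V: "V \<in> Syl"
    and cU: "card (norm_in G U (U \<inter> V)) = p ^ multiplicity p (card (norm_in G (carrier G) (U \<inter> V)))"
    and cV: "card (norm_in G V (U \<inter> V)) = p ^ multiplicity p (card (norm_in G (carrier G) (U \<inter> V)))"
    and ZU: "at_sylow Z U \<subset> U \<inter> V" and proper: "U \<inter> V \<subset> U"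
  shows "\<exists>c\<in>carrier G. (\<forall>x\<in>U \<inter> V. c \<otimes> x \<otimes> inv c = x)
        \<and> conj_set G c (norm_in G U (U \<inter> V)) = norm_in G V (U \<inter> V)"
proof -
  let ?u = "rep U" and ?R = "U \<inter> V" and ?C = "conj_set G (inv (rep U))"
  let ?Q = "?C V"
  have u: "?u \<in> carrier G" and iu: "inv ?u \<in> carrier G" using rep_closed[OF U] by auto
  have UG: "U \<subseteq> carrier G" and VG: "V \<subseteq> carrier G" and RG: "?R \<subseteq> carrier G"
    using Syl_carrier[OF U] Syl_carrier[OF V] by auto
  have CU: "?C U = P" using conj_rep[OF U] conj_set_inv_cancel(1)[OF u P_carrier] by simp
  have CR: "?C ?R = P \<inter> ?Q" using conj_set_Int[OF iu UG VG] CU by simp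
  have nP: "norm_in G P (P \<inter> ?Q) = ?C (norm_in G U ?R)"
    using norm_in_conj[OF iu UG RG] CU CR by simp
  have nQ: "norm_in G ?Q (P \<inter> ?Q) = ?C (norm_in G V ?R)"
    using norm_in_conj[OF iu VG RG] CR by simp
  have nG: "norm_in G (carrier G) (P \<inter> ?Q) = ?C (norm_in G (carrier G) ?R)"
    using norm_in_conj[OF iu _ RG, of "carrier G"] conj_set_self[OF subgroup_self iu] CR by simp
  have sub: "norm_in G H ?R \<subseteq> carrier G" if "H \<subseteq> carrier G" for H
    using that by (auto simp: norm_in_def)
  have crd: "card (?C (norm_in G H ?R)) = card (norm_in G H ?R)" if "H \<subseteq> carrier G" for H
    using card_conj_set[OF iu sub[OF that]] .
  have "?C (at_sylow Z U) = Z"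
    using conj_set_inv_cancel(1)[OF u Z_carrier] by (simp add: at_sylow_def)
  then have ZR: "Z \<subset> P \<inter> ?Q" using conj_set_psubset[OF iu ZU RG] CR by simp
  have RP: "P \<inter> ?Q \<subset> P" using conj_set_psubset[OF iu proper UG] CU CR by simp
  obtain c where c: "c \<in> carrier G" and cent: "\<And>x. x \<in> P \<inter> ?Q \<Longrightarrow> c \<otimes> x \<otimes> inv c = x"
    and cc: "conj_set G c (norm_in G P (P \<inter> ?Q)) = norm_in G ?Q (P \<inter> ?Q)"
    using tame_conj[OF Syl_conj[OF V iu] _ _ ZR RP] cU cV nP nQ nG crd[OF UG] crd[OF VG] crd[of "carrier G"]
    by auto
  let ?d = "?u \<otimes> c \<otimes> inv ?u"
  have d: "?d \<in> carrier G" using u c by simp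
  have "?d \<otimes> x \<otimes> inv ?d = x" if x: "x \<in> ?R" for x
  proof -
    have xG: "x \<in> carrier G" using x RG by auto
    have "inv ?u \<otimes> x \<otimes> inv (inv ?u) \<in> ?C ?R" using x by (auto simp: conj_set_def)
    then have "c \<otimes> (inv ?u \<otimes> x \<otimes> ?u) \<otimes> inv c = inv ?u \<otimes> x \<otimes> ?u"
      using cent CR u by simp
    moreover have "?d \<otimes> x \<otimes> inv ?d = ?u \<otimes> (c \<otimes> (inv ?u \<otimes> x \<otimes> ?u) \<otimes> inv c) \<otimes> inv ?u"
      using u c xG by (simp add: m_assoc inv_mult_group)
    ultimately show ?thesis using conj_cancel(2)[OF u xG] by simp
  qed
  moreover have "conj_set G ?d (norm_in G U ?R) = norm_in G V ?R"
  proof -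
    have "conj_set G ?d (norm_in G U ?R) = conj_set G ?u (conj_set G c (?C (norm_in G U ?R)))"
      using u c iu sub[OF UG] by (simp add: conj_set_mult m_assoc)
    also have "\<dots> = conj_set G ?u (?C (norm_in G V ?R))" using cc nP nQ by simp
    finally show ?thesis using conj_set_inv_cancel(2)[OF u sub[OF VG]] by simp
  qed
  ultimately show ?thesis using d by blast
qed

end

locale central_transfer = sylow_transfer G p P A lam + tame_centralizer_fusion G p P Z
  for G (structure) and p P and A (structure) and lam Z
begin

text \<open>Induction on the intersection \<open>R\<close>, from larger to smaller. Sylow subgroups \<open>U1\<close> and \<open>U2\<close> are chosen
above \<open>N_(Q1)(R)\<close> and \<open>N_(Q2)(R)\<close> such that their normalizers of \<open>R\<close> are Sylow in \<open>N_G(R)\<close>. Both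
\<open>Q1 \<inter> U1\<close> and \<open>U2 \<inter> Q2\<close> are larger than \<open>R\<close>. If \<open>U1 \<inter> U2 = R\<close>, this intersection is tame, and
replacing \<open>U1\<close> by its conjugate under an element centralizing \<open>R\<close> makes the intersection larger.
The equality of the copies of \<open>Z\<close> has to be carried along: it guarantees that each new pair again
meets strictly above its own copy of \<open>Z\<close>.\<close>

lemma lam_at_agree:
  assumes "Q1 \<in> Syl" "Q2 \<in> Syl" "at_sylow Z Q1 \<subset> Q1 \<inter> Q2"
  shows "at_sylow Z Q1 = at_sylow Z Q2 \<and> (\<forall>x\<in>Q1 \<inter> Q2. lam_at Q1 x = lam_at Q2 x)"
  using assms
proof (induction "card P - card (Q1 \<inter> Q2)" arbitrary: Q1 Q2 rule: less_induct)
  case less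
  note Q1 = less.prems(1) and Q2 = less.prems(2) and ZR = less.prems(3)
  let ?R = "Q1 \<inter> Q2"
  have Q1G: "Q1 \<subseteq> carrier G" and Q2G: "Q2 \<subseteq> carrier G" and RG: "?R \<subseteq> carrier G"
    using Syl_carrier[OF Q1] Syl_carrier[OF Q2] by auto
  have R: "subgroup ?R G" using subgroups_Inter_pair[OF Syl_subgroup[OF Q1] Syl_subgroup[OF Q2]] .
  show ?case
  proof (cases "Q1 = Q2")
    case False
    then have RQ1: "?R \<subset> Q1" and RQ2: "?R \<subset> Q2"
      using Syl_subset_imp_eq[OF Q1 Q2] Syl_subset_imp_eq[OF Q2 Q1] by auto
    \<comment> \<open>The form of the induction hypothesis used for pairs that share a proper overgroup of the current intersection\<close>
    have IH: "at_sylow Z V = at_sylow Z Q1 \<and> (\<forall>x\<in>?R. lam_at U x = lam_at V x)"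
      if U: "U \<in> Syl" and V: "V \<in> Syl" and RS: "?R \<subset> S" "S \<subseteq> U \<inter> V" and ZU: "at_sylow Z U = at_sylow Z Q1"
      for U V S
    proof -
      have UV: "U \<inter> V \<subseteq> U" "finite U" using Syl_finite[OF U] by auto
      then have "card ?R < card (U \<inter> V)" using RS by (intro psubset_card_mono) auto
      moreover have "card (U \<inter> V) \<le> card P"
        using card_mono[OF UV(2,1)] card_Syl_eq[OF U] card_P by simp
      ultimately have "card P - card (U \<inter> V) < card P - card ?R" by linarith
      moreover have "at_sylow Z U \<subset> U \<inter> V" using ZR RS ZU by auto
      ultimately have "at_sylow Z U = at_sylow Z V \<and> (\<forall>x\<in>U \<inter> V. lam_at U x = lam_at V x)"
        using less.hyps[OF _ U V] by simp
      moreover have "?R \<subseteq> U \<inter> V" using RS by blast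
      ultimately show ?thesis using ZU by (metis subsetD)
    qed
    let ?M = "norm_in G (carrier G) ?R"
    have M: "subgroup ?M G" using subgroup_norm_in[OF subgroup_self RG] .
    have nb: "\<exists>S U. subgroup S G \<and> ?R \<subset> S \<and> S \<subseteq> Q \<and> U \<in> Syl \<and> S \<subseteq> U
        \<and> card (norm_in G U ?R) = p ^ multiplicity p (card ?M)"
      if Q: "Q \<in> Syl" and RQ: "?R \<subset> Q" for Q
    proof -
      let ?S = "norm_in G Q ?R"
      have S: "subgroup ?S G" using subgroup_norm_in[OF Syl_subgroup[OF Q] RG] .
      have SQ: "?S \<subseteq> Q" by (auto simp: norm_in_def)
      obtain y where y: "y \<in> Q - ?R" "conj_set G y ?R = ?R"
        using normalizer_grows[OF fin prime_p Syl_subgroup[OF Q] card_Syl_eq[OF Q] R RQ] by blast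
      have "?R \<subseteq> ?S" using RQ conj_set_self[OF R] by (auto simp: norm_in_def)
      then have RS: "?R \<subset> ?S" using y by (auto simp: norm_in_def)
      have "card ?S dvd card Q"
        using group.card_subgroup_dvd[OF subgroup_imp_group[OF Syl_subgroup[OF Q]]
            subgroup_in_subgroup[OF S Syl_subgroup[OF Q] SQ]] by (simp add: order_def)
      then obtain k where k: "card ?S = p ^ k"
        using card_Syl_eq[OF Q] prime_p by (metis divides_primepow_nat)
      have SM: "?S \<subseteq> ?M" using Syl_carrier[OF Q] by (auto simp: norm_in_def)
      obtain g where g: "g \<in> carrier G" "?S \<subseteq> conj_set G g P"
        "card (conj_set G g P \<inter> ?M) = p ^ multiplicity p (card ?M)"
        using p_subgroup_extends_to_sylow[OF fin prime_p P_subgroup card_P M S k SM] by blast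
      have U: "conj_set G g P \<in> Syl" using Syl_conj[OF P_in_Syl g(1)] .
      have "conj_set G g P \<inter> ?M = norm_in G (conj_set G g P) ?R"
        using Syl_carrier[OF U] by (auto simp: norm_in_def)
      then show ?thesis using S RS SQ U g by auto
    qed
    obtain S1 U1 where S1: "?R \<subset> S1" "S1 \<subseteq> Q1" "S1 \<subseteq> U1" and U1: "U1 \<in> Syl"
      and c1: "card (norm_in G U1 ?R) = p ^ multiplicity p (card ?M)"
      using nb[OF Q1 RQ1] by blast
    obtain S2 U2 where S2: "?R \<subset> S2" "S2 \<subseteq> Q2" "S2 \<subseteq> U2" and U2: "U2 \<in> Syl"
      and c2: "card (norm_in G U2 ?R) = p ^ multiplicity p (card ?M)"
      using nb[OF Q2 RQ2] by blast
    have step1: "at_sylow Z U1 = at_sylow Z Q1 \<and> (\<forall>x\<in>?R. lam_at Q1 x = lam_at U1 x)"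
      using IH[OF Q1 U1 S1(1)] S1 by auto
    have step2: "at_sylow Z U2 = at_sylow Z Q1 \<and> (\<forall>x\<in>?R. lam_at U1 x = lam_at U2 x)"
    proof (cases "U1 \<inter> U2 = ?R")
      case False
      then have "?R \<subset> U1 \<inter> U2" using S1 S2 by auto
      then show ?thesis using IH[OF U1 U2] step1 by auto
    next
      case True
      have "U1 \<inter> U2 \<subset> U1" using True S1 by auto
      moreover have "at_sylow Z U1 \<subset> U1 \<inter> U2" using step1 ZR True by simp
      ultimately have "\<exists>c\<in>carrier G. (\<forall>x\<in>U1 \<inter> U2. c \<otimes> x \<otimes> inv c = x)
          \<and> conj_set G c (norm_in G U1 (U1 \<inter> U2)) = norm_in G U2 (U1 \<inter> U2)"
        using c1 c2 by (intro tame_conj_general[OF U1 U2]) (simp_all only: True)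
      then obtain c where c: "c \<in> carrier G" and cent: "\<And>x. x \<in> ?R \<Longrightarrow> c \<otimes> x \<otimes> inv c = x"
        and cc: "conj_set G c (norm_in G U1 ?R) = norm_in G U2 ?R"
        unfolding True by blast
      \<comment> \<open>Since c centralizes R, passing from U1 to its conjugate V changes neither the copy of Z nor the values on R.\<close>
      let ?V = "conj_set G c U1"
      have V: "?V \<in> Syl" using Syl_conj[OF U1 c] .
      have RU1: "?R \<subseteq> U1" and RU2: "?R \<subset> U2" using S1 S2 by auto
      have "conj_set G c (at_sylow Z U1) = at_sylow Z U1"
      proof -
        have "at_sylow Z U1 \<subseteq> ?R" using step1 ZR by auto
        then show ?thesis unfolding conj_set_def using cent by (force simp: subset_iff)
      qed
      then have ZV: "at_sylow Z ?V = at_sylow Z Q1"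
        using conj_at_sylow[OF Z_carrier N_fixes_Z U1 c] step1 by simp
      have lamV: "lam_at ?V x = lam_at U1 x" if x: "x \<in> ?R" for x
        using lam_at_conj[OF U1 mem_norm_Syl[OF U1] c, of x] cent[OF x] x RU1 by auto
      have "norm_in G U2 ?R \<subseteq> ?V \<inter> U2"
        using cc conj_set_mono[of "norm_in G U1 ?R" U1 c] by (auto simp: norm_in_def)
      moreover have "?R \<subset> norm_in G U2 ?R"
      proof -
        obtain y where "y \<in> U2 - ?R" "conj_set G y ?R = ?R"
          using normalizer_grows[OF fin prime_p Syl_subgroup[OF U2] card_Syl_eq[OF U2] R RU2] by blast
        moreover have "?R \<subseteq> norm_in G U2 ?R" using RU2 conj_set_self[OF R] by (auto simp: norm_in_def)
        ultimately show ?thesis by (auto simp: norm_in_def)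
      qed
      ultimately have "at_sylow Z U2 = at_sylow Z Q1 \<and> (\<forall>x\<in>?R. lam_at ?V x = lam_at U2 x)"
        using IH[OF V U2] ZV by blast
      then show ?thesis using lamV by simp
    qed
    have step3: "at_sylow Z Q2 = at_sylow Z Q1 \<and> (\<forall>x\<in>?R. lam_at U2 x = lam_at Q2 x)"
      using IH[OF U2 Q2 S2(1)] S2 step2 by auto
    show ?thesis using step1 step2 step3 by auto
  qed simp
qed

end

section \<open>Cancellation along a central series\<close>

text \<open>The sequence \<open>W\<close> stands for the upper central series of \<open>P\<close>, and \<open>W (p - 1)\<close> for the subgroup \<open>Z\<close>
of the fusion hypothesis.\<close>

locale central_series = tame_centralizer_fusion G p P "W (p - 1)"
  for G (structure) and p P and W :: "nat \<Rightarrow> 'a set" +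
  assumes W_0: "W 0 = {\<one>}"
    and W_subgroup: "\<And>j. subgroup (W j) G"
    and W_subset_P: "\<And>j. W j \<subseteq> P"
    and W_mono: "\<And>j. W j \<subseteq> W (Suc j)"
    and W_comm: "\<And>j x g. x \<in> W (Suc j) \<Longrightarrow> g \<in> P \<Longrightarrow> x \<otimes> g \<otimes> inv x \<otimes> inv g \<in> W j"
    and W_normal: "\<And>j g. g \<in> P \<Longrightarrow> conj_set G g (W j) = W j"

locale central_series_transfer =
  central_transfer G p P A lam "W (p - 1)" + central_series G p P W + minimal_element G p P A lam u
  for G (structure) and p P and A (structure) and lam and W :: "nat \<Rightarrow> 'a set" and u +
  assumes u_in_P: "u \<in> P"
begin

lemma W_carrier: "W j \<subseteq> carrier G"
  using W_subset_P P_carrier by blast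

lemma W_le: "i \<le> j \<Longrightarrow> W i \<subseteq> W j"
  by (rule lift_Suc_mono_le[of W, OF W_mono])

lemma W_conj_mem: "g \<in> P \<Longrightarrow> w \<in> W j \<Longrightarrow> g \<otimes> w \<otimes> inv g \<in> W j"
  using W_normal[of g j] by (auto simp: conj_set_def)

lemma P_inv_mem: "x \<in> P \<Longrightarrow> inv x \<in> P"
  using subgroup.m_inv_closed[OF P_subgroup] .

lemma P_pow_mem: "x \<in> P \<Longrightarrow> x [^] (i::nat) \<in> P"
  using Syl_pow_closed[OF P_in_Syl] .

text \<open>Each further commutator with \<open>x\<close> descends one step of the series. Truncated subtraction fits: once
\<open>W 0\<close> is reached, all later commutators are trivial.\<close>

lemma iter_comm_in_W:
  assumes x: "x \<in> P" and k: "iter_comm x k \<in> W m"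
  shows "iter_comm x (k + l) \<in> W (m - l)"
proof (induction l)
  case (Suc l)
  let ?c = "iter_comm x (k + l)"
  have xG: "x \<in> carrier G" using x P_carrier by auto
  have c: "?c \<in> W (m - l)" by (rule Suc.IH)
  have cG: "?c \<in> carrier G" using c W_carrier by auto
  show ?case
  proof (cases "m - l")
    case 0
    then have "?c = \<one>" using c W_0 by simp
    then have "iter_comm x (k + Suc l) = \<one>" using xG by (simp add: iter_comm_Suc)
    then show ?thesis using subgroup.one_closed[OF W_subgroup] by simp
  next
    case (Suc n)
    then have "inv ?c \<in> W (Suc n)" using c subgroup.m_inv_closed[OF W_subgroup] by auto
    from W_comm[OF this x] have "inv ?c \<otimes> x \<otimes> ?c \<otimes> inv x \<in> W n" using cG by simp
    then have "iter_comm x (k + Suc l) \<in> W n" using cG xG by (simp add: iter_comm_Suc m_assoc)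
    moreover have "m - Suc l = n" using Suc by simp
    ultimately show ?thesis by simp
  qed
qed (use k in simp)

text \<open>The last of the powers \<open>y, y^p, y^(p^2), ...\<close> outside \<open>D\<close>.\<close>

lemma exists_pth_root_outside:
  assumes D: "subgroup D G" and y: "y \<in> P" "y \<notin> D"
  shows "\<exists>n. y [^] (n::nat) \<notin> D \<and> (y [^] n) [^] p \<in> D"
proof -
  have yG: "y \<in> carrier G" using y P_carrier by auto
  obtain k where k: "ord y = p ^ k" using ord_Syl[OF P_in_Syl y(1)] .
  have "y [^] (p ^ k) \<in> D" using pow_ord_eq_1[OF yG] k subgroup.one_closed[OF D] by simp
  moreover have "\<not> y [^] (p ^ 0) \<in> D" using y yG by simp
  ultimately obtain i where "\<not> y [^] (p ^ i) \<in> D" "y [^] (p ^ Suc i) \<in> D"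
    using ex_least_nat_less[of "\<lambda>i. y [^] (p ^ i) \<in> D" k] by auto
  then show ?thesis using nat_pow_pow[OF yG, of "p ^ i" p] by (auto simp: mult.commute)
qed

abbreviation "lam_prod X \<equiv> finprod A (\<lambda>Q. lam_at Q u) X"

lemma lam_prod_split:
  assumes "X \<subseteq> {Q \<in> Syl. u \<in> Q}"
  shows "lam_prod X = lam_prod {Q \<in> X. R Q} \<otimes>\<^bsub>A\<^esub> lam_prod {Q \<in> X. \<not> R Q}"
proof (rule A.finprod_split)
  show "finite X" using assms finite_Syl finite_subset[of X Syl] by blast
  show "(\<lambda>Q. lam_at Q u) \<in> X \<rightarrow> carrier A" using assms lam_at_closed mem_norm_Syl by blast
qed

lemma lam_prod_closed: "X \<subseteq> {Q \<in> Syl. u \<in> Q} \<Longrightarrow> lam_prod X \<in> carrier A"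
  using lam_at_closed mem_norm_Syl by (intro A.finprod_closed) blast

text \<open>On such \<open>Q\<close> the group \<open>D = Q \<inter> W (j+1)\<close> is a proper subgroup of \<open>W (j+1)\<close> containing \<open>W j\<close>.
Elements \<open>x\<close> of \<open>W (j+1)\<close> are central modulo \<open>W j\<close>, so conjugation by \<open>x\<close> preserves \<open>D\<close> and keeps \<open>u\<close>
in \<open>Q\<close>. For fixed \<open>D\<close> one element \<open>x\<close> outside \<open>D\<close> with \<open>x^p \<in> D\<close> serves all \<open>Q\<close> at once, which is why
the product is split into the fibres of the map from \<open>Q\<close> to \<open>D\<close>. As \<open>[u, x]\<close> lies in \<open>W j\<close> and
\<open>j + 1 \<le> p - 1\<close>, the \<open>(p-1)\<close>-fold commutator is trivial.\<close>

lemma lam_prod_layer: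
  assumes j: "Suc j \<le> p - 1"
  shows "lam_prod {Q \<in> Syl. u \<in> Q \<and> W j \<subseteq> Q \<and> \<not> W (Suc j) \<subseteq> Q} = \<one>\<^bsub>A\<^esub>"
proof (rule A.finprod_fibres_eq_one[where key = "\<lambda>Q. Q \<inter> W (Suc j)"])
  let ?X = "{Q \<in> Syl. u \<in> Q \<and> W j \<subseteq> Q \<and> \<not> W (Suc j) \<subseteq> Q}"
  show "finite ?X" using finite_Syl by simp
  show "(\<lambda>Q. lam_at Q u) \<in> ?X \<rightarrow> carrier A" using lam_at_closed mem_norm_Syl by blast
  fix D assume "D \<in> (\<lambda>Q. Q \<inter> W (Suc j)) ` ?X"
  then obtain Q0 where Q0: "Q0 \<in> Syl" "W j \<subseteq> Q0" "\<not> W (Suc j) \<subseteq> Q0" and D: "D = Q0 \<inter> W (Suc j)"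
    by blast
  have Dsub: "subgroup D G"
    unfolding D using subgroups_Inter_pair[OF Syl_subgroup[OF Q0(1)] W_subgroup] .
  have WD: "W j \<subseteq> D" using D Q0(2) W_mono by blast
  have DG: "D \<subseteq> carrier G" using subgroup.subset[OF Dsub] .
  obtain y where y: "y \<in> W (Suc j)" "y \<notin> D" using D Q0(3) by blast
  obtain n where n: "y [^] n \<notin> D" "(y [^] (n::nat)) [^] p \<in> D"
    using exists_pth_root_outside[OF Dsub _ y(2)] y(1) W_subset_P by blast
  define x where "x = y [^] n"
  have pow_W: "z [^] (i::nat) \<in> W (Suc j)" if "z \<in> W (Suc j)" for z i
    using that subgroup.one_closed[OF W_subgroup] subgroup.m_closed[OF W_subgroup]
    by (induction i) auto
  have xW: "x \<in> W (Suc j)" using pow_W[OF y(1)] by (simp add: x_def)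
  have x: "x \<notin> D" "x [^] p \<in> D" using n by (simp_all add: x_def)
  have xP: "x \<in> P" using xW W_subset_P by blast
  have xG: "x \<in> carrier G" using xP P_carrier by blast
  \<comment> \<open>The commutator of z and g lies in W j, so z g z^-1 and g belong to the same members of the family.\<close>
  have move: "z \<otimes> g \<otimes> inv z \<in> Q" if z: "z \<in> W (Suc j)" and g: "g \<in> P" "g \<in> Q" and Q: "Q \<in> Syl" "W j \<subseteq> Q" for z g Q
  proof -
    have "z \<otimes> g \<otimes> inv z \<otimes> inv g \<in> Q" using W_comm[OF z g(1)] Q(2) by blast
    then have "(z \<otimes> g \<otimes> inv z \<otimes> inv g) \<otimes> g \<in> Q"
      using subgroup.m_closed[OF Syl_subgroup[OF Q(1)]] g(2) by blast
    moreover have "z \<in> carrier G" "g \<in> carrier G" using z g W_carrier P_carrier by auto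
    ultimately show ?thesis by (simp add: m_assoc)
  qed
  have first: "iter_comm x 1 \<in> W j"
  proof -
    have "x \<otimes> inv u \<otimes> inv x \<otimes> inv (inv u) \<in> W j" using W_comm[OF xW P_inv_mem[OF u_in_P]] .
    then have "inv (x \<otimes> inv u \<otimes> inv x \<otimes> inv (inv u)) \<in> W j"
      using subgroup.m_inv_closed[OF W_subgroup] by blast
    then show ?thesis using xG u_closed by (simp add: iter_comm_Suc m_assoc inv_mult_group)
  qed
  have conjD: "conj_set G (inv x) D = D"
  proof (rule card_subset_eq)
    show "finite D" using DG fin finite_subset by blast
    show "card (conj_set G (inv x) D) = card D" using card_conj_set xG DG by simp
    show "conj_set G (inv x) D \<subseteq> D"
    proof
      fix d assume "d \<in> conj_set G (inv x) D"
      then obtain e where e: "e \<in> D" "d = inv x \<otimes> e \<otimes> inv (inv x)" by (auto simp: conj_set_def)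
      have ixW: "inv x \<in> W (Suc j)" using xW subgroup.m_inv_closed[OF W_subgroup] by blast
      have "e \<in> P" "e \<in> Q0" "e \<in> W (Suc j)" using e(1) D W_subset_P by blast+
      then show "d \<in> D"
        using e(2) D move[OF ixW _ _ Q0(1,2), of e] W_conj_mem[of "inv x" e "Suc j"] P_inv_mem[OF xP] by simp
    qed
  qed
  let ?F = "{Q \<in> ?X. Q \<inter> W (Suc j) = D}"
  show "lam_prod ?F = \<one>\<^bsub>A\<^esub>"
  proof (rule finprod_conj_family[OF _ xP])
    show "?F \<subseteq> Syl" by blast
  next
    fix Q assume Q: "Q \<in> ?F"
    have QS: "Q \<in> Syl" and QG: "Q \<subseteq> carrier G" using Q Syl_carrier by auto
    have "x \<otimes> u \<otimes> inv x \<in> Q" using move[OF xW u_in_P _ QS] Q by blast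
    then have "u \<in> conj_set G (inv x) Q" using mem_conj_set[of "inv x" Q u] xG QG u_closed by simp
    moreover have "W j \<subseteq> conj_set G (inv x) Q"
      using conj_set_mono[of "W j" Q "inv x"] W_normal[OF P_inv_mem[OF xP]] Q by simp
    moreover have cap: "conj_set G (inv x) Q \<inter> W (Suc j) = D"
      using conj_set_Int[of "inv x" Q "W (Suc j)"] xG QG W_carrier W_normal[OF P_inv_mem[OF xP]] Q conjD
      by simp
    moreover have "\<not> W (Suc j) \<subseteq> conj_set G (inv x) Q" using cap y by blast
    ultimately show "conj_set G (inv x) Q \<in> ?F" using Syl_conj[OF QS, of "inv x"] xG by simp
  next
    fix Q assume "Q \<in> ?F"
    then show "x \<notin> Q" "x [^] p \<in> Q" using x xW by blast+
  next
    fix Q k and i :: nat assume Q: "Q \<in> ?F"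
    show "x [^] i \<otimes> iter_comm x k \<otimes> inv (x [^] i) \<in> Q"
    proof (cases k)
      case 0
      then show ?thesis using move[OF pow_W[OF xW] u_in_P, of Q i] Q by simp
    next
      case (Suc l)
      have "iter_comm x k \<in> W (j - l)" using iter_comm_in_W[OF xP first, of l] Suc by simp
      then have "iter_comm x k \<in> W j" by (rule subsetD[OF W_le[OF diff_le_self]])
      then have "x [^] i \<otimes> iter_comm x k \<otimes> inv (x [^] i) \<in> W j"
        by (rule W_conj_mem[OF P_pow_mem[OF xP]])
      then show ?thesis using Q by blast
    qed
  next
    show "iter_comm x (p - 1) = \<one>"
    proof -
      have "1 + (p - 2) = p - 1" "j - (p - 2) = 0" using j by linarith+
      then show ?thesis using iter_comm_in_W[OF xP first, of "p - 2"] W_0 by (simp only: singleton_iff)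
    qed
  qed
qed

lemma lam_prod_not_containing_W:
  "j \<le> p - 1 \<Longrightarrow> lam_prod {Q \<in> Syl. u \<in> Q} = lam_prod {Q \<in> Syl. u \<in> Q \<and> W j \<subseteq> Q}"
proof (induction j)
  case 0
  have "W 0 \<subseteq> Q" if "Q \<in> Syl" for Q
    using W_0 subgroup.one_closed[OF Syl_subgroup[OF that]] by simp
  then show ?case by (metis (no_types, lifting))
next
  case (Suc j)
  let ?X = "{Q \<in> Syl. u \<in> Q \<and> W j \<subseteq> Q}"
  have e1: "{Q \<in> ?X. W (Suc j) \<subseteq> Q} = {Q \<in> Syl. u \<in> Q \<and> W (Suc j) \<subseteq> Q}" using W_mono by blast
  have e2: "{Q \<in> ?X. \<not> W (Suc j) \<subseteq> Q} = {Q \<in> Syl. u \<in> Q \<and> W j \<subseteq> Q \<and> \<not> W (Suc j) \<subseteq> Q}" by blast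
  have "lam_prod ?X = lam_prod {Q \<in> ?X. W (Suc j) \<subseteq> Q} \<otimes>\<^bsub>A\<^esub> lam_prod {Q \<in> ?X. \<not> W (Suc j) \<subseteq> Q}"
    by (rule lam_prod_split) blast
  also have "\<dots> = lam_prod {Q \<in> Syl. u \<in> Q \<and> W (Suc j) \<subseteq> Q}"
    unfolding e1 e2 lam_prod_layer[OF Suc.prems] by (rule A.r_one[OF lam_prod_closed]) blast
  finally show ?case using Suc by simp
qed

text \<open>Here \<open>u\<close> itself lies in \<open>W (p-1)\<close>, so \<open>p - 1\<close> commutators with any element of \<open>P\<close> make it trivial,
and any \<open>x\<close> in \<open>P\<close> outside \<open>W (p-1)\<close> with \<open>x^p\<close> inside yields blocks.\<close>

lemma lam_prod_intersection_eq_Z: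
  "lam_prod {Q \<in> Syl. u \<in> Q \<and> Q \<noteq> P \<and> P \<inter> Q = W (p - 1)} = \<one>\<^bsub>A\<^esub>" (is "lam_prod ?X = _")
proof (cases "?X = {}")
  case True
  then show ?thesis by (simp only: A.finprod_empty)
next
  case False
  let ?Z = "W (p - 1)"
  obtain Q0 where Q0: "Q0 \<in> Syl" "Q0 \<noteq> P" "P \<inter> Q0 = ?Z" "u \<in> Q0" using False by blast
  have uZ: "u \<in> ?Z" using Q0 u_in_P by blast
  have "\<not> P \<subseteq> ?Z" using Q0 Syl_subset_imp_eq[OF P_in_Syl Q0(1)] by blast
  then obtain y where y: "y \<in> P" "y \<notin> ?Z" by blast
  obtain n where n: "y [^] n \<notin> ?Z" "(y [^] (n::nat)) [^] p \<in> ?Z"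
    using exists_pth_root_outside[OF W_subgroup y] by blast
  define x where "x = y [^] n"
  have xP: "x \<in> P" using P_pow_mem[OF y(1)] by (simp add: x_def)
  have xG: "x \<in> carrier G" using xP P_carrier by blast
  have x: "x \<notin> ?Z" "x [^] p \<in> ?Z" using n by (simp_all add: x_def)
  have iP: "conj_set G (inv x) P = P" using conj_set_self[OF P_subgroup P_inv_mem[OF xP]] .
  have X_eq: "?X = {Q \<in> Syl. Q \<noteq> P \<and> P \<inter> Q = ?Z}" using uZ by blast
  show ?thesis
    unfolding X_eq
  proof (rule finprod_conj_family[OF _ xP])
    fix Q assume "Q \<in> {Q \<in> Syl. Q \<noteq> P \<and> P \<inter> Q = ?Z}"
    then have Q: "Q \<in> Syl" "Q \<noteq> P" "P \<inter> Q = ?Z" by auto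
    have "P \<inter> conj_set G (inv x) Q = ?Z"
      using conj_set_Int[of "inv x" P Q] xG P_carrier Syl_carrier[OF Q(1)] iP Q(3)
        W_normal[OF P_inv_mem[OF xP], of "p - 1"] by simp
    moreover from this have "conj_set G (inv x) Q \<noteq> P"
      using \<open>\<not> P \<subseteq> ?Z\<close> by auto
    ultimately show "conj_set G (inv x) Q \<in> {Q \<in> Syl. Q \<noteq> P \<and> P \<inter> Q = ?Z}"
      using Syl_conj[OF Q(1), of "inv x"] xG by simp
    show "x \<notin> Q" "x [^] p \<in> Q" using x xP Q(3) by blast+
    fix k and i :: nat
    have "iter_comm x k \<in> W (p - 1 - k)" using iter_comm_in_W[OF xP, of 0 "p - 1" k] uZ by simp
    then have "iter_comm x k \<in> ?Z" by (rule subsetD[OF W_le[OF diff_le_self]])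
    then have "x [^] i \<otimes> iter_comm x k \<otimes> inv (x [^] i) \<in> ?Z"
      by (rule W_conj_mem[OF P_pow_mem[OF xP]])
    then show "x [^] i \<otimes> iter_comm x k \<otimes> inv (x [^] i) \<in> Q" using Q(3) by blast
  next
    show "iter_comm x (p - 1) = \<one>"
      using iter_comm_in_W[OF xP, of 0 "p - 1" "p - 1"] uZ W_0 by simp
  qed blast
qed

text \<open>By fusion every factor equals \<open>lam u\<close>, whose \<open>p\<close>-th power is \<open>lam (u^p) = 1\<close>. The number of factors is
divisible by \<open>p\<close>: without the condition \<open>u \<in> Q\<close> the family is permuted by \<open>P\<close> without fixed points,
and the members not containing \<open>u\<close> are those moved by the group generated by \<open>u\<close>.\<close>

lemma lam_prod_intersection_above_Z:
  "lam_prod {Q \<in> Syl. u \<in> Q \<and> Q \<noteq> P \<and> W (p - 1) \<subset> P \<inter> Q} = \<one>\<^bsub>A\<^esub>" (is "lam_prod ?X = _")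
proof -
  let ?Z = "W (p - 1)"
  let ?S = "{Q \<in> Syl. Q \<noteq> P \<and> ?Z \<subset> P \<inter> Q}"
  have uN: "u \<in> N" using u_in_P P_subset_N by blast
  have closed: "conj_set G h Q \<in> ?S" if h: "h \<in> P" and Q: "Q \<in> ?S" for h Q
  proof -
    have hG: "h \<in> carrier G" using h P_carrier by blast
    have QG: "Q \<subseteq> carrier G" using Q Syl_carrier by blast
    have hP: "conj_set G h P = P" using conj_set_self[OF P_subgroup h] .
    have "conj_set G h ?Z \<subset> conj_set G h (P \<inter> Q)"
      using Q QG by (intro conj_set_psubset[OF hG]) auto
    then have "?Z \<subset> P \<inter> conj_set G h Q"
      using conj_set_Int[OF hG P_carrier QG] hP W_normal[OF h] by simp
    moreover have "conj_set G h Q \<noteq> P"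
    proof
      assume "conj_set G h Q = P"
      then have "Q = P"
        using conj_set_inv_cancel(1)[OF hG QG] conj_set_self[OF P_subgroup P_inv_mem[OF h]] by simp
      then show False using Q by simp
    qed
    ultimately show ?thesis using Syl_conj[OF _ hG, of Q] Q by simp
  qed
  have "p dvd card ?S"
  proof (rule p_dvd_card_Syl_moved_by_P)
    show "conj_set G h Q \<in> ?S" if "h \<in> P" "Q \<in> ?S" for h Q using closed[OF that] .
  qed auto
  let ?H = "generate G {u}"
  have H: "subgroup ?H G" using generate_is_subgroup u_closed by blast
  obtain k where k: "ord u = p ^ k" using ord_u by blast
  have cH: "card ?H = p ^ k" using card_generate_singleton[OF fin u_closed] k by simp
  have HP: "?H \<subseteq> P" using u_in_P P_subgroup by (intro generate_subgroup_incl) auto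
  have "p dvd card {Q \<in> ?S. \<exists>h\<in>?H. conj_set G h Q \<noteq> Q}"
  proof (rule p_dvd_card_conj_moved[OF H cH prime_p])
    show "finite ?S" using finite_Syl by simp
    show "Q \<subseteq> carrier G" if "Q \<in> ?S" for Q using that Syl_carrier[of Q] by simp
    show "conj_set G h Q \<in> ?S" if "h \<in> ?H" "Q \<in> ?S" for h Q
      by (rule closed[OF subsetD[OF HP that(1)] that(2)])
  qed
  moreover have "finite ?S" using finite_Syl by simp
  ultimately have "p dvd card {Q \<in> ?S. \<not> (\<exists>h\<in>?H. conj_set G h Q \<noteq> Q)}"
    by (intro dvd_card_complement \<open>p dvd card ?S\<close>)
  also have "{Q \<in> ?S. \<not> (\<exists>h\<in>?H. conj_set G h Q \<noteq> Q)} = ?X"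
  proof -
    have "(\<forall>h\<in>?H. conj_set G h Q = Q) \<longleftrightarrow> u \<in> Q" if Q: "Q \<in> Syl" for Q
    proof
      assume "\<forall>h\<in>?H. conj_set G h Q = Q"
      then show "u \<in> Q" using u_normalizes_iff[OF Q] generate.incl[of u "{u}" G] by blast
    next
      assume "u \<in> Q"
      then have "?H \<subseteq> Q" using Syl_subgroup[OF Q] by (intro generate_subgroup_incl) auto
      then show "\<forall>h\<in>?H. conj_set G h Q = Q" using conj_set_self[OF Syl_subgroup[OF Q]] by blast
    qed
    then show ?thesis by blast
  qed
  finally obtain m where m: "card ?X = p * m" by blast
  have "lam_prod ?X = finprod A (\<lambda>Q. lam u) ?X"
  proof (rule A.finprod_cong')
    fix Q assume Q: "Q \<in> ?X"
    then have "at_sylow ?Z P \<subset> P \<inter> Q" using at_sylow_P[OF N_fixes_Z] by simp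
    then have "lam_at P u = lam_at Q u" using lam_at_agree[OF P_in_Syl, of Q] Q u_in_P by blast
    then show "lam_at Q u = lam u" using lam_at_P[OF uN] by simp
  qed (use lam_closed[OF uN] in auto)
  also have "\<dots> = lam u [^]\<^bsub>A\<^esub> (p * m)"
    using A.finprod_const[OF lam_closed[OF uN], of ?X] m by simp
  also have "\<dots> = (lam u [^]\<^bsub>A\<^esub> p) [^]\<^bsub>A\<^esub> m" using lam_closed[OF uN] by (simp add: A.nat_pow_pow)
  also have "lam u [^]\<^bsub>A\<^esub> p = \<one>\<^bsub>A\<^esub>"
  proof -
    have "lam_at P (u [^] p) = \<one>\<^bsub>A\<^esub>"
      using ord_power_less[OF p_dvd_ord_u prime_gt_1_nat[OF prime_p]]
      by (intro lam_at_small[OF P_in_Syl mem_norm_Syl[OF P_in_Syl P_pow_mem[OF u_in_P]]])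
    then show ?thesis using lam_at_pow[OF P_in_Syl u_in_P, of p] lam_at_P[OF uN] by simp
  qed
  finally show ?thesis by simp
qed

theorem transfer_minimal_element: "transfer u = lam u"
proof -
  let ?Z = "W (p - 1)" and ?X = "{Q \<in> Syl. u \<in> Q \<and> W (p - 1) \<subseteq> Q}"
  have uN: "u \<in> N" using u_in_P P_subset_N by blast
  let ?Y = "{Q \<in> ?X. \<not> Q = P}"
  have P_part: "{Q \<in> ?X. Q = P} = {P}" using P_in_Syl u_in_P W_subset_P by auto
  have e1: "{Q \<in> ?Y. P \<inter> Q = ?Z} = {Q \<in> Syl. u \<in> Q \<and> Q \<noteq> P \<and> P \<inter> Q = ?Z}" by blast
  have e2: "{Q \<in> ?Y. \<not> P \<inter> Q = ?Z} = {Q \<in> Syl. u \<in> Q \<and> Q \<noteq> P \<and> ?Z \<subset> P \<inter> Q}"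
    using W_subset_P by blast
  have "lam_prod ?Y = lam_prod {Q \<in> ?Y. P \<inter> Q = ?Z} \<otimes>\<^bsub>A\<^esub> lam_prod {Q \<in> ?Y. \<not> P \<inter> Q = ?Z}"
    by (rule lam_prod_split) blast
  also have "\<dots> = \<one>\<^bsub>A\<^esub>"
    unfolding e1 e2 lam_prod_intersection_eq_Z lam_prod_intersection_above_Z by simp
  finally have Y: "lam_prod ?Y = \<one>\<^bsub>A\<^esub>" .
  have "transfer u = lam_prod ?X"
    unfolding transfer_eq_finprod_containing by (rule lam_prod_not_containing_W) simp
  also have "\<dots> = lam_prod {Q \<in> ?X. Q = P} \<otimes>\<^bsub>A\<^esub> lam_prod ?Y"
    by (rule lam_prod_split) blast
  also have "\<dots> = lam_prod {P}" unfolding Y P_part using lam_prod_closed[of "{P}"] P_in_Syl u_in_P by simp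
  also have "\<dots> = lam_at P u"
    using lam_at_closed[OF P_in_Syl mem_norm_Syl[OF P_in_Syl u_in_P]]
    by (subst A.finprod_insert) auto
  finally show ?thesis using lam_at_P[OF uN] by simp
qed

end

section \<open>Upper central series, p-nilpotent normalizers and the residual\<close>

context group
begin

lemma rcos_eq_iff:
  assumes H: "subgroup H G" and x: "x \<in> carrier G" and y: "y \<in> carrier G"
  shows "H #> x = H #> y \<longleftrightarrow> x \<otimes> inv y \<in> H"
  using repr_independence[of x H y] repr_independenceD[OF H, of x y]
    subgroup.rcos_module[OF H is_group y x] x y H by metis

lemma rcos_eq_self_iff: "subgroup H G \<Longrightarrow> x \<in> carrier G \<Longrightarrow> H #> x = H \<longleftrightarrow> x \<in> H"
  using coset_join1[of H x] coset_join2[of x H] subgroup.subset[of H G] by blast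

text \<open>The commutator description replaces the center of the quotient; normality of the previous term is what
makes the quotient multiplication computable on representatives.\<close>

lemma mem_upper_central_Suc:
  assumes "upper_central G k \<lhd> G"
  shows "x \<in> upper_central G (Suc k) \<longleftrightarrow>
    x \<in> carrier G \<and> (\<forall>g\<in>carrier G. x \<otimes> g \<otimes> inv x \<otimes> inv g \<in> upper_central G k)"
proof -
  let ?K = "upper_central G k"
  interpret K: normal ?K G by (rule assms)
  have "(?K #> x) \<otimes>\<^bsub>G Mod ?K\<^esub> (?K #> g) = (?K #> g) \<otimes>\<^bsub>G Mod ?K\<^esub> (?K #> x)
      \<longleftrightarrow> x \<otimes> g \<otimes> inv x \<otimes> inv g \<in> ?K"
    if x: "x \<in> carrier G" and g: "g \<in> carrier G" for g
    using rcos_eq_iff[OF K.subgroup_axioms, of "x \<otimes> g" "g \<otimes> x"] x g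
    by (simp add: K.rcos_sum inv_mult_group m_assoc)
  then show ?thesis by (auto simp: group_center_def carrier_FactGroup)
qed

lemma upper_central_normal: "upper_central G k \<lhd> G"
proof (induction k)
  case 0
  then show ?case by (simp add: one_is_normal)
next
  case (Suc k)
  let ?K = "upper_central G k" and ?L = "upper_central G (Suc k)"
  interpret K: normal ?K G by (rule Suc.IH)
  note mem = mem_upper_central_Suc[OF Suc.IH]
  have conjK: "g \<otimes> k \<otimes> inv g \<in> ?K" if "g \<in> carrier G" "k \<in> ?K" for g k
    using K.inv_op_closed2 that by blast
  have LG: "x \<in> carrier G" if "x \<in> ?L" for x using that mem by blast
  have comm: "x \<otimes> g \<otimes> inv x \<otimes> inv g \<in> ?K" if "x \<in> ?L" "g \<in> carrier G" for x g using that mem by blast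
  have "subgroup ?L G"
  proof (rule subgroupI)
    show "?L \<subseteq> carrier G" using LG by blast
    have "\<one> \<in> ?L" unfolding mem by simp
    then show "?L \<noteq> {}" by blast
  next
    fix x assume x: "x \<in> ?L"
    have "inv x \<otimes> g \<otimes> inv (inv x) \<otimes> inv g \<in> ?K" if g: "g \<in> carrier G" for g
    proof -
      have "inv x \<otimes> inv (x \<otimes> g \<otimes> inv x \<otimes> inv g) \<otimes> inv (inv x) \<in> ?K"
        using conjK[OF inv_closed[OF LG[OF x]]] K.m_inv_closed[OF comm[OF x g]] by blast
      then show ?thesis using LG[OF x] g by (simp add: m_assoc inv_mult_group inv_cancel_left)
    qed
    then show "inv x \<in> ?L" unfolding mem using LG[OF x] by simp
  next
    fix x y assume x: "x \<in> ?L" and y: "y \<in> ?L"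
    have "(x \<otimes> y) \<otimes> g \<otimes> inv (x \<otimes> y) \<otimes> inv g \<in> ?K" if g: "g \<in> carrier G" for g
    proof -
      have "x \<otimes> (y \<otimes> g \<otimes> inv y \<otimes> inv g) \<otimes> inv x \<otimes> (x \<otimes> g \<otimes> inv x \<otimes> inv g) \<in> ?K"
        using conjK[OF LG[OF x] comm[OF y g]] comm[OF x g] by (rule K.m_closed)
      then show ?thesis using LG[OF x] LG[OF y] g by (simp add: m_assoc inv_mult_group inv_cancel_left)
    qed
    then show "x \<otimes> y \<in> ?L" unfolding mem using LG[OF x] LG[OF y] by simp
  qed
  moreover have "h \<otimes> x \<otimes> inv h \<in> ?L" if h: "h \<in> carrier G" and x: "x \<in> ?L" for h x
  proof -
    have "(h \<otimes> x \<otimes> inv h) \<otimes> g \<otimes> inv (h \<otimes> x \<otimes> inv h) \<otimes> inv g \<in> ?K" if g: "g \<in> carrier G" for g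
    proof -
      have "h \<otimes> (x \<otimes> (inv h \<otimes> g \<otimes> h) \<otimes> inv x \<otimes> inv (inv h \<otimes> g \<otimes> h)) \<otimes> inv h \<in> ?K"
        using conjK[OF h comm[OF x]] h g by simp
      then show ?thesis using LG[OF x] h g by (simp add: m_assoc inv_mult_group inv_cancel_left)
    qed
    then show ?thesis unfolding mem using LG[OF x] h by simp
  qed
  ultimately show ?case by (simp only: normal_inv_iff) blast
qed

lemma upper_central_mono: "upper_central G k \<subseteq> upper_central G (Suc k)"
proof
  interpret K: normal "upper_central G k" G by (rule upper_central_normal)
  fix x assume x: "x \<in> upper_central G k"
  have "x \<otimes> g \<otimes> inv x \<otimes> inv g \<in> upper_central G k" if g: "g \<in> carrier G" for g
  proof -
    have "x \<otimes> (g \<otimes> inv x \<otimes> inv g) \<in> upper_central G k"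
      using K.m_closed[OF x K.inv_op_closed2[OF g K.m_inv_closed[OF x]]] .
    moreover have "x \<in> carrier G" using x K.subset by blast
    ultimately show ?thesis using g by (simp add: m_assoc)
  qed
  then show "x \<in> upper_central G (Suc k)"
    using mem_upper_central_Suc[OF upper_central_normal, of x k] x K.subset by blast
qed

lemma upper_central_subset: "upper_central G k \<subseteq> carrier G"
  by (rule subgroup.subset[OF normal_imp_subgroup[OF upper_central_normal]])

end

text \<open>An element normalizing \<open>P\<close> induces an automorphism of \<open>P\<close>, and the upper central series is
characteristic.\<close>

lemma (in group) conj_upper_central:
  assumes P: "subgroup P G" and n: "n \<in> carrier G" "conj_set G n P = P"
  shows "conj_set G n (upper_central (G\<lparr>carrier := P\<rparr>) k) = upper_central (G\<lparr>carrier := P\<rparr>) k"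
proof -
  let ?P = "G\<lparr>carrier := P\<rparr>"
  interpret P: group ?P using P subgroup_imp_group by blast
  let ?U = "upper_central ?P"
  have PG: "P \<subseteq> carrier G" using subgroup.subset[OF P] .
  have UP: "?U j \<subseteq> P" for j using P.upper_central_subset by simp
  have mem: "x \<in> ?U (Suc j) \<longleftrightarrow> x \<in> P \<and> (\<forall>g\<in>P. x \<otimes> g \<otimes> inv x \<otimes> inv g \<in> ?U j)" for x j
    using P.mem_upper_central_Suc[OF P.upper_central_normal, of x j] m_inv_consistent[OF P]
    by (simp cong: conj_cong)
  have half: "m \<otimes> x \<otimes> inv m \<in> ?U k" if "m \<in> carrier G" "conj_set G m P = P" "x \<in> ?U k" for m x
    using that
  proof (induction k arbitrary: x)
    case 0
    then show ?case by simp
  next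
    case (Suc j)
    note m = Suc.prems(1,2)
    have x: "x \<in> P" "\<And>g. g \<in> P \<Longrightarrow> x \<otimes> g \<otimes> inv x \<otimes> inv g \<in> ?U j" using Suc.prems(3) mem by blast+
    have xG: "x \<in> carrier G" using x(1) PG by blast
    have "m \<otimes> x \<otimes> inv m \<in> P" using m(2) x(1) by (auto simp: conj_set_def)
    moreover have "(m \<otimes> x \<otimes> inv m) \<otimes> g \<otimes> inv (m \<otimes> x \<otimes> inv m) \<otimes> inv g \<in> ?U j" if g: "g \<in> P" for g
    proof -
      have gG: "g \<in> carrier G" using g PG by blast
      have "inv m \<otimes> g \<otimes> m \<in> P" using g m(2) mem_conj_set[OF m(1) PG, of g] by simp
      from Suc.IH[OF m x(2)[OF this]]
      have "m \<otimes> (x \<otimes> (inv m \<otimes> g \<otimes> m) \<otimes> inv x \<otimes> inv (inv m \<otimes> g \<otimes> m)) \<otimes> inv m \<in> ?U j" .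
      then show ?thesis using xG gG m(1) by (simp add: m_assoc inv_mult_group inv_cancel_left)
    qed
    ultimately show ?case using mem by blast
  qed
  have inv_P: "conj_set G (inv n) P = P" using conj_set_inv_cancel(1)[OF n(1) PG] n(2) by simp
  show ?thesis
  proof
    show "conj_set G n (?U k) \<subseteq> ?U k" using half[OF n] by (auto simp: conj_set_def)
    have UG: "?U k \<subseteq> carrier G" using UP PG by blast
    show "?U k \<subseteq> conj_set G n (?U k)"
    proof
      fix x assume x: "x \<in> ?U k"
      then have "inv n \<otimes> x \<otimes> inv (inv n) \<in> ?U k" using half[OF inv_closed[OF n(1)] inv_P] by blast
      then show "x \<in> conj_set G n (?U k)" using mem_conj_set[OF n(1) UG, of x] n(1) x UG by auto
    qed
  qed
qed

text \<open>With \<open>K\<close> the normal \<open>p\<close>-complement, every coset of \<open>S\<close> has a representative in \<open>K\<close>, so \<open>S\<close> and \<open>T\<close>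
are conjugate by an element of \<open>K\<close>. The normal subgroups \<open>K\<close> and \<open>R\<close> have coprime orders, hence commute.\<close>

lemma (in group) p_nilpotent_sylow_conj_centralizing:
  assumes fin: "finite (carrier G)" and p: "Factorial_Ring.prime (p::nat)"
    and nil: "p_nilpotent p G"
    and R: "R \<lhd> G" "card R = p ^ r"
    and S: "subgroup S G" "card S = p ^ multiplicity p (order G)"
    and T: "subgroup T G" "card T = p ^ multiplicity p (order G)"
  shows "\<exists>c\<in>carrier G. (\<forall>x\<in>R. c \<otimes> x \<otimes> inv c = x) \<and> conj_set G c S = T"
proof -
  obtain K n where K: "K \<lhd> G" and cop: "coprime (card K) p" and idx: "card (rcosets K) = p ^ n"
    using nil by (auto simp: p_nilpotent_def)
  interpret K: normal K G by (rule K)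
  interpret R: normal R G by (rule R)
  have KS: "subgroup K G" and RS: "subgroup R G" using K.subgroup_axioms R.subgroup_axioms by auto
  have SG: "S \<subseteq> carrier G" using subgroup.subset[OF S(1)] .
  have meet: "H \<inter> K = {\<one>}" if H: "subgroup H G" "card H = p ^ i" for H i
  proof -
    have I: "subgroup (H \<inter> K) G" using subgroups_Inter_pair[OF H(1) KS] .
    have "card (H \<inter> K) dvd card H" "card (H \<inter> K) dvd card K"
      using group.card_subgroup_dvd[OF subgroup_imp_group[OF H(1)] subgroup_in_subgroup[OF I H(1)]]
        group.card_subgroup_dvd[OF subgroup_imp_group[OF KS] subgroup_in_subgroup[OF I KS]]
      by (simp_all add: order_def)
    moreover have "coprime (card K) (card H)" using cop H(2) by simp
    ultimately have "card (H \<inter> K) = 1" by (metis coprime_common_divisor_nat)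
    then obtain e where "H \<inter> K = {e}" by (auto simp: card_1_singleton_iff)
    then show ?thesis using subgroup.one_closed[OF I] by auto
  qed
  obtain h where h: "h \<in> carrier G" "T \<subseteq> conj_set G h S"
    using p_subgroup_subset_conj_sylow[OF fin p S T] by blast
  have "finite (conj_set G h S)" using fin SG by (simp add: conj_set_def finite_subset)
  then have Th: "T = conj_set G h S"
    using card_subset_eq[of "conj_set G h S" T] h card_conj_set[OF h(1) SG] S(2) T(2) by simp
  let ?f = "\<lambda>k. S #> k"
  have "inj_on ?f K"
  proof (rule inj_onI)
    fix a b assume ab: "a \<in> K" "b \<in> K" "S #> a = S #> b"
    then have "a \<otimes> inv b \<in> S \<inter> K" using rcos_eq_iff[OF S(1), of a b] by simp
    then have "a \<otimes> inv b = \<one>" using meet[OF S] by simp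
    then show "a = b" using ab inv_equality[of a "inv b"] by simp
  qed
  then have cf: "card (?f ` K) = card K" by (rule card_image)
  \<comment> \<open>Counting shows that the injection of K into the cosets of S is onto.\<close>
  have "p ^ n dvd order G" using lagrange[OF KS] idx by (metis dvd_triv_left)
  then have "n \<le> multiplicity p (order G)"
    using p fin order_gt_0_iff_finite by (intro multiplicity_geI) auto
  then have pn: "p ^ n \<le> p ^ multiplicity p (order G)"
    using power_increasing[OF _ prime_ge_1_nat[OF p]] by simp
  have e: "card (rcosets S) * p ^ multiplicity p (order G) = p ^ n * card K"
    using lagrange[OF S(1)] lagrange[OF KS] S(2) idx by simp
  have "card (rcosets S) * p ^ n \<le> card K * p ^ n"
    using mult_le_mono2[OF pn, of "card (rcosets S)"] e by (simp add: mult.commute)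
  then have "card (rcosets S) \<le> card K" using prime_gt_0_nat[OF p] by simp
  moreover have "?f ` K \<subseteq> rcosets S" using rcosetsI[OF SG] K.subset by blast
  moreover have "finite (rcosets S)" using finite_subset[OF rcosets_subset_PowG[OF S(1)]] fin by simp
  ultimately have "?f ` K = rcosets S" using cf by (metis card_seteq)
  moreover have "S #> inv h \<in> rcosets S" using h(1) by (auto simp: RCOSETS_def)
  ultimately obtain k where k: "k \<in> K" "S #> inv h = S #> k" by blast
  have kG: "k \<in> carrier G" using k(1) by simp
  \<comment> \<open>The representative k of the coset of h^-1 replaces h: both conjugate S to T.\<close>
  have s: "inv h \<otimes> inv k \<in> S" using rcos_eq_iff[OF S(1) inv_closed[OF h(1)] kG] k(2) by simp
  let ?s = "inv (inv h \<otimes> inv k)"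
  have sS: "?s \<in> S" using subgroup.m_inv_closed[OF S(1) s] .
  have "h = inv k \<otimes> ?s" using h(1) kG by (simp add: inv_mult_group inv_cancel_left)
  then have "T = conj_set G (inv k) (conj_set G ?s S)"
    using Th conj_set_mult[of "inv k" ?s S] kG h(1) SG by simp
  then have "conj_set G (inv k) S = T" using conj_set_self[OF S(1) sS] by simp
  moreover have "inv k \<otimes> x \<otimes> inv (inv k) = x" if x: "x \<in> R" for x
  proof -
    have xG: "x \<in> carrier G" using x by simp
    have "inv k \<otimes> x \<otimes> inv (inv k) \<otimes> inv x \<in> R"
      using R.m_closed[OF R.inv_op_closed2[OF inv_closed[OF kG] x] R.m_inv_closed[OF x]] .
    moreover have "inv k \<otimes> (x \<otimes> k \<otimes> inv x) \<in> K"
      using K.m_closed[OF K.m_inv_closed[OF k(1)] K.inv_op_closed2[OF xG k(1)]] .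
    ultimately have "inv k \<otimes> x \<otimes> inv (inv k) \<otimes> inv x \<in> R \<inter> K"
      using xG kG by (simp add: m_assoc)
    then have "inv k \<otimes> x \<otimes> inv (inv k) \<otimes> inv x = \<one>" using meet[OF RS R(2)] by simp
    then show ?thesis using inv_equality[of "inv k \<otimes> x \<otimes> inv (inv k)" "inv x"] xG kG by simp
  qed
  ultimately show ?thesis using inv_closed[OF kG] by blast
qed

definition abelian_p_quotient_kernels :: "nat \<Rightarrow> ('a, 'b) monoid_scheme \<Rightarrow> 'a set set"
  where "abelian_p_quotient_kernels p G = {N. N \<lhd> G \<and> comm_group (G Mod N) \<and> p_group p (G Mod N)}"

lemma p_group_card_subgroup:
  assumes "group A" "p_group p A" "Factorial_Ring.prime p" "subgroup H A"
  shows "p_group p (A\<lparr>carrier := H\<rparr>)"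
  using group.card_subgroup_dvd[OF assms(1,4)] assms(2,3)
  by (auto simp: p_group_def order_def divides_primepow_nat)

lemma (in group_hom) kernel_abelian_p_quotient:
  assumes A: "comm_group H" "p_group p H" and p: "Factorial_Ring.prime p"
  shows "kernel G H h \<in> abelian_p_quotient_kernels p G"
proof -
  interpret A: comm_group H by (rule A)
  let ?I = "h ` carrier G" and ?J = "H\<lparr>carrier := h ` carrier G\<rparr>"
  have I: "subgroup ?I H" by (rule img_is_subgroup)
  have "comm_group ?J"
    by (rule group.group_comm_groupI[OF H.subgroup_imp_group[OF I]]) (auto simp: A.m_comm)
  then interpret J: comm_group ?J .
  have hJ: "group_hom G ?J h"
    by (simp add: group_hom_def group_hom_axioms_def hom_def J.is_group G.is_group)
  have "kernel G ?J h = kernel G H h" by (simp add: kernel_def)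
  then have iso: "G Mod kernel G H h \<cong> ?J" using group_hom.FactGroup_iso[OF hJ] by simp
  have N: "kernel G H h \<lhd> G" by (rule normal_kernel)
  have grp: "group (G Mod kernel G H h)" using normal.factorgroup_is_group[OF N] .
  have "?J \<cong> G Mod kernel G H h" using group.iso_sym[OF grp iso] .
  then have "comm_group (G Mod kernel G H h)" using J.iso_imp_comm_group grp group.is_monoid by blast
  moreover have "p_group p (G Mod kernel G H h)"
    using p_group_card_subgroup[OF H.is_group A(2) p I] iso_same_card[OF iso]
    by (simp add: p_group_def order_def)
  ultimately show ?thesis using N by (simp add: abelian_p_quotient_kernels_def)
qed

context group
begin

text \<open>\<open>M \<inter> N\<close> is the kernel of the map to the product of the two quotients.\<close>

lemma Int_abelian_p_quotient:
  assumes p: "Factorial_Ring.prime p"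
    and M: "M \<in> abelian_p_quotient_kernels p G" and N: "N \<in> abelian_p_quotient_kernels p G"
  shows "M \<inter> N \<in> abelian_p_quotient_kernels p G"
proof -
  interpret M: normal M G using M by (simp add: abelian_p_quotient_kernels_def)
  interpret N: normal N G using N by (simp add: abelian_p_quotient_kernels_def)
  interpret QM: comm_group "G Mod M" using M by (simp add: abelian_p_quotient_kernels_def)
  interpret QN: comm_group "G Mod N" using N by (simp add: abelian_p_quotient_kernels_def)
  let ?A = "(G Mod M) \<times>\<times> (G Mod N)" and ?f = "\<lambda>x. (M #> x, N #> x)"
  have grp: "group ?A" using DirProd_group QM.is_group QN.is_group by blast
  have "comm_group ?A"
  proof (rule group.group_comm_groupI[OF grp])
    fix x y assume "x \<in> carrier ?A" "y \<in> carrier ?A"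
    then show "x \<otimes>\<^bsub>?A\<^esub> y = y \<otimes>\<^bsub>?A\<^esub> x"
      using QM.m_comm QN.m_comm by (auto simp: DirProd_def)
  qed
  moreover have "p_group p ?A"
  proof -
    obtain a b where "order (G Mod M) = p ^ a" "order (G Mod N) = p ^ b"
      using M N by (auto simp: abelian_p_quotient_kernels_def p_group_def)
    then have "order ?A = p ^ (a + b)" by (simp add: order_def card_cartesian_product power_add)
    then show ?thesis by (auto simp: p_group_def)
  qed
  moreover have "group_hom G ?A ?f"
    using grp is_group M.r_coset_hom_Mod N.r_coset_hom_Mod
    by (simp add: group_hom_def group_hom_axioms_def hom_paired)
  moreover have "kernel G ?A ?f = M \<inter> N"
    using rcos_eq_self_iff[OF M.subgroup_axioms] rcos_eq_self_iff[OF N.subgroup_axioms] M.subset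
    by (auto simp: kernel_def)
  ultimately show ?thesis using group_hom.kernel_abelian_p_quotient[of G ?A ?f p] p by simp
qed

text \<open>A member of least cardinality is contained in every other member, because the family is closed under
intersections. This is what gives the least element in the definition of \<open>A^p(G)\<close> its meaning.\<close>

lemma abelian_p_residual:
  assumes fin: "finite (carrier G)" and p: "Factorial_Ring.prime p"
  shows abelian_p_residual_mem: "abelian_p_residual p G \<in> abelian_p_quotient_kernels p G"
    and abelian_p_residual_least: "\<And>N. N \<in> abelian_p_quotient_kernels p G \<Longrightarrow> abelian_p_residual p G \<subseteq> N"
proof -
  let ?F = "abelian_p_quotient_kernels p G"
  let ?T = "G\<lparr>carrier := {\<one>}\<rparr>"
  have T: "group ?T" using triv_subgroup subgroup_imp_group by blast
  have "comm_group ?T" by (rule group.group_comm_groupI[OF T]) simp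
  moreover have "p_group p ?T" unfolding p_group_def order_def by (intro exI[of _ 0]) simp
  moreover have "group_hom G ?T (\<lambda>x. \<one>)"
    using T is_group by (simp add: group_hom_def group_hom_axioms_def hom_def)
  ultimately have "?F \<noteq> {}" using group_hom.kernel_abelian_p_quotient p by blast
  moreover have FG: "N \<subseteq> carrier G" if "N \<in> ?F" for N
    using that normal_imp_subgroup subgroup.subset unfolding abelian_p_quotient_kernels_def by blast
  ultimately obtain N where N: "N \<in> ?F" and min: "\<And>M. M \<in> ?F \<Longrightarrow> card N \<le> card M"
    using ex_has_least_nat[of "\<lambda>N. N \<in> ?F" _ card] by blast
  have least: "N \<subseteq> M" if M: "M \<in> ?F" for M
  proof -
    have "card N \<le> card (N \<inter> M)" using min Int_abelian_p_quotient[OF p N M] by blast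
    moreover have "finite N" using FG[OF N] fin finite_subset by blast
    ultimately have "N \<inter> M = N" by (intro card_seteq) auto
    then show ?thesis by blast
  qed
  have "abelian_p_residual p G = N"
    unfolding abelian_p_residual_def
    using N least by (intro Least_equality) (auto simp: abelian_p_quotient_kernels_def)
  then show "abelian_p_residual p G \<in> ?F" "\<And>N. N \<in> ?F \<Longrightarrow> abelian_p_residual p G \<subseteq> N"
    using N least by auto
qed

lemma hom_abelian_p_residual:
  assumes "finite (carrier G)" "Factorial_Ring.prime p"
    and "comm_group A" "p_group p A" "phi \<in> hom G A" "x \<in> abelian_p_residual p G"
  shows "phi x = \<one>\<^bsub>A\<^esub>"
proof -
  have "group_hom G A phi"
    using assms(3,5) is_group by (simp add: group_hom_def group_hom_axioms_def comm_group.axioms(2))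
  then have "kernel G A phi \<in> abelian_p_quotient_kernels p G"
    using group_hom.kernel_abelian_p_quotient assms by blast
  then have "x \<in> kernel G A phi" using abelian_p_residual_least assms by blast
  then show ?thesis by (simp add: kernel_def)
qed

end

section \<open>Control of p-transfer\<close>

lemma prime_power_of_unique_prime_divisor:
  assumes "Factorial_Ring.prime (p::nat)" "n > 0" "\<And>q. Factorial_Ring.prime q \<Longrightarrow> q dvd n \<Longrightarrow> q = p"
  shows "\<exists>k. n = p ^ k"
proof -
  obtain m where m: "n = m * p ^ multiplicity p n"
    using multiplicity_dvd[of p n] by (metis dvd_div_mult_self)
  have "\<not> p dvd m" using not_dvd_cofactor[OF assms(1,2) m] .
  then have "m = 1"
    using assms(3) m prime_factor_nat[of m] by (metis dvd_mult2)
  then show ?thesis using m by auto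
qed

lemma (in comm_group) finprod_in_subgroup:
  assumes H: "subgroup H G" and X: "finite X" "f \<in> X \<rightarrow> H"
  shows "finprod G f X \<in> H"
  using X
proof (induction X rule: finite_induct)
  case (insert x X)
  then have "f \<in> X \<rightarrow> carrier G" "f x \<in> carrier G" using subgroup.subset[OF H] by auto
  then show ?case using insert subgroup.m_closed[OF H] by (simp add: Pi_iff)
qed (simp add: subgroup.one_closed[OF H])

lemma (in comm_group) finprod_pow:
  assumes "finite X" "f \<in> X \<rightarrow> carrier G"
  shows "finprod G (\<lambda>x. f x [^] (n::nat)) X = finprod G f X [^] n"
  using assms
proof (induction X rule: finite_induct)
  case (insert x X)
  then have "f \<in> X \<rightarrow> carrier G" "f x \<in> carrier G" by auto
  then show ?case using insert by (simp add: Pi_iff nat_pow_distrib)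
qed simp

lemma (in group) coprime_pow_mem:
  assumes H: "subgroup H G" and x: "x \<in> carrier G" "x [^] (m::nat) \<in> H" "x [^] (n::nat) = \<one>"
    and mn: "coprime m n" and m: "m > 0"
  shows "x \<in> H"
proof -
  obtain s t where st: "m * s = n * t + 1"
    using bezout_nat[of m n] mn m by auto
  have "(x [^] m) [^] s \<in> H"
    using x(2) subgroup.one_closed[OF H] subgroup.m_closed[OF H] by (induction s) auto
  moreover have "(x [^] m) [^] s = (x [^] n) [^] t \<otimes> x"
    using x(1) st by (simp add: nat_pow_pow)
  ultimately show ?thesis using x by simp
qed

context central_series
begin

text \<open>An element \<open>u\<close> of minimal order outside the kernel has \<open>p\<close>-power order: for a prime \<open>q \<noteq> p\<close> dividing it,
\<open>lam u^q = lam (u^q) = 1\<close>, while \<open>lam u\<close> has \<open>p\<close>-power order.\<close>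

lemma lam_trivial_if_transfer_trivial:
  assumes A: "comm_group A" and ordA: "p_group p A"
    and lam: "lam \<in> hom (G\<lparr>carrier := N\<rparr>) A"
    and triv: "\<And>g. g \<in> carrier G \<Longrightarrow> sylow_transfer.transfer G P A lam g = \<one>\<^bsub>A\<^esub>"
    and n: "n \<in> N"
  shows "lam n = \<one>\<^bsub>A\<^esub>"
proof (rule ccontr)
  assume "lam n \<noteq> \<one>\<^bsub>A\<^esub>"
  interpret T: sylow_transfer G p P A lam
    using sylow_group_axioms A lam
    by (auto simp: sylow_transfer_def sylow_transfer_axioms_def)
  obtain a where a: "order A = p ^ a" using ordA by (auto simp: p_group_def)
  obtain u where u: "u \<in> N" "lam u \<noteq> \<one>\<^bsub>A\<^esub>"
    and min: "\<And>y. y \<in> N \<Longrightarrow> lam y \<noteq> \<one>\<^bsub>A\<^esub> \<Longrightarrow> ord u \<le> ord y"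
    using ex_has_least_nat[of "\<lambda>y. y \<in> N \<and> lam y \<noteq> \<one>\<^bsub>A\<^esub>" n ord] n \<open>lam n \<noteq> \<one>\<^bsub>A\<^esub>\<close> by blast
  have uG: "u \<in> carrier G" using u N_carrier by blast
  have pos: "ord u > 0" using ord_ge_1[OF fin uG] by simp
  have pow: "lam (u [^] k) = lam u [^]\<^bsub>A\<^esub> k \<and> u [^] k \<in> N" for k :: nat
    using u subgroup.m_closed[OF N_subgroup] subgroup.one_closed[OF N_subgroup]
    by (induction k) (auto simp: T.lam_one T.lam_mult)
  have "q = p" if q: "Factorial_Ring.prime q" "q dvd ord u" for q
  proof (rule ccontr)
    assume "q \<noteq> p"
    have "ord (u [^] q) = ord u div q"
      using ord_pow_gen[OF uG, of q] q by (auto simp: gcd_proj2_if_dvd)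
    then have "ord (u [^] q) < ord u" using prime_gt_1_nat[OF q(1)] pos by simp
    then have "lam u [^]\<^bsub>A\<^esub> q = \<one>\<^bsub>A\<^esub>" using min[of "u [^] q"] pow[of q] by force
    then have "group.ord A (lam u) dvd q" using T.A.pow_eq_id[OF T.lam_closed[OF u(1)]] by blast
    moreover have "group.ord A (lam u) dvd p ^ a"
      using T.A.ord_dvd_group_order[OF T.lam_closed[OF u(1)]] a by simp
    moreover have "coprime q (p ^ a)"
      using primes_coprime[OF q(1) prime_p \<open>q \<noteq> p\<close>] by simp
    ultimately have "group.ord A (lam u) = 1" by (metis coprime_common_divisor_nat)
    then show False using T.A.ord_eq_1[OF T.lam_closed[OF u(1)]] u(2) by simp
  qed
  then obtain k where k: "ord u = p ^ k"
    using prime_power_of_unique_prime_divisor[OF prime_p pos] by blast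
  have "conj_set G u P = P" using u(1) mem_N_iff by blast
  then have uP: "u \<in> P" using p_element_normalizing_Syl[OF P_in_Syl uG k] by blast
  have "u \<noteq> \<one>" using u(2) T.lam_one by auto
  then interpret C: central_series_transfer G p P A lam W u
    using uG k uP min by unfold_locales (force simp: not_le)+
  show False using C.transfer_minimal_element triv[OF uG] u(2) by simp
qed

text \<open>The auxiliary homomorphism \<open>mu = lam^m / transfer\<close>, with \<open>m\<close> the number of Sylow subgroups, has trivial
transfer, because the transfer of the restriction of \<open>transfer\<close> is its \<open>m\<close>-th power. Hence \<open>mu\<close> is
trivial, and \<open>lam^m\<close> extends to the homomorphism \<open>transfer\<close> on \<open>G\<close>, which kills \<open>A^p(G)\<close>.\<close>

lemma lam_abelian_p_residual:
  assumes A: "comm_group A" and ordA: "p_group p A"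
    and lam: "lam \<in> hom (G\<lparr>carrier := N\<rparr>) A"
    and n: "n \<in> N" "n \<in> abelian_p_residual p G"
  shows "lam n = \<one>\<^bsub>A\<^esub>"
proof -
  interpret T: sylow_transfer G p P A lam
    using sylow_group_axioms A lam
    by (auto simp: sylow_transfer_def sylow_transfer_axioms_def)
  let ?m = "card Syl" and ?t = T.transfer
  interpret t: group_hom G A ?t
    using T.transfer_hom by (simp add: group_hom_def group_hom_axioms_def is_group T.A.is_group)
  obtain a where a: "order A = p ^ a" using ordA by (auto simp: p_group_def)
  define mu where "mu x = lam x [^]\<^bsub>A\<^esub> ?m \<otimes>\<^bsub>A\<^esub> inv\<^bsub>A\<^esub> (?t x)" for x
  have tc: "?t x \<in> carrier A" if "x \<in> N" for x using that N_carrier by auto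
  have mu_hom: "mu \<in> hom (G\<lparr>carrier := N\<rparr>) A"
  proof (rule homI)
    fix x assume "x \<in> carrier (G\<lparr>carrier := N\<rparr>)"
    then show "mu x \<in> carrier A" using T.lam_closed tc by (simp add: mu_def)
  next
    fix x y assume "x \<in> carrier (G\<lparr>carrier := N\<rparr>)" "y \<in> carrier (G\<lparr>carrier := N\<rparr>)"
    then have xy: "x \<in> N" "y \<in> N" and xyG: "x \<in> carrier G" "y \<in> carrier G" using N_carrier by auto
    note cl = T.lam_closed[OF xy(1)] T.lam_closed[OF xy(2)] tc[OF xy(1)] tc[OF xy(2)]
    have "mu (x \<otimes> y) = (lam x [^]\<^bsub>A\<^esub> ?m \<otimes>\<^bsub>A\<^esub> lam y [^]\<^bsub>A\<^esub> ?m) \<otimes>\<^bsub>A\<^esub> (inv\<^bsub>A\<^esub> (?t x) \<otimes>\<^bsub>A\<^esub> inv\<^bsub>A\<^esub> (?t y))"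
      using cl xyG T.lam_mult[OF xy] by (simp add: mu_def T.A.nat_pow_distrib T.A.inv_mult)
    also have "\<dots> = mu x \<otimes>\<^bsub>A\<^esub> mu y"
      using cl by (simp add: mu_def T.A.m_ac)
    finally show "mu (x \<otimes>\<^bsub>G\<lparr>carrier := N\<rparr>\<^esub> y) = mu x \<otimes>\<^bsub>A\<^esub> mu y" by simp
  qed
  interpret M: sylow_transfer G p P A mu
    using sylow_group_axioms A mu_hom
    by (auto simp: sylow_transfer_def sylow_transfer_axioms_def)
  have "M.transfer g = \<one>\<^bsub>A\<^esub>" if g: "g \<in> carrier G" for g
  proof -
    have l: "(\<lambda>Q. lam (cocycle Q g)) \<in> Syl \<rightarrow> carrier A" using cocycle_in_N[OF _ g] T.lam_closed by auto
    have m: "(\<lambda>Q. mu (cocycle Q g)) \<in> Syl \<rightarrow> carrier A" using cocycle_in_N[OF _ g] M.lam_closed by auto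
    have t: "(\<lambda>Q. ?t (cocycle Q g)) \<in> Syl \<rightarrow> carrier A" using cocycle_in_N[OF _ g] tc by auto
    have "M.transfer g \<otimes>\<^bsub>A\<^esub> ?t g [^]\<^bsub>A\<^esub> ?m
        = finprod A (\<lambda>Q. mu (cocycle Q g)) Syl \<otimes>\<^bsub>A\<^esub> finprod A (\<lambda>Q. ?t (cocycle Q g)) Syl"
      using finprod_hom_cocycle[OF A T.transfer_hom g] by (simp add: M.transfer_def)
    also have "\<dots> = finprod A (\<lambda>Q. mu (cocycle Q g) \<otimes>\<^bsub>A\<^esub> ?t (cocycle Q g)) Syl"
      using T.A.finprod_multf[OF m t] by simp
    also have "\<dots> = finprod A (\<lambda>Q. lam (cocycle Q g) [^]\<^bsub>A\<^esub> ?m) Syl"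
    proof (rule T.A.finprod_cong')
      fix Q assume Q: "Q \<in> Syl"
      show "mu (cocycle Q g) \<otimes>\<^bsub>A\<^esub> ?t (cocycle Q g) = lam (cocycle Q g) [^]\<^bsub>A\<^esub> ?m"
        using T.lam_closed[OF cocycle_in_N[OF Q g]] tc[OF cocycle_in_N[OF Q g]]
        by (simp add: mu_def T.A.m_assoc)
    qed (use l in auto)
    also have "\<dots> = ?t g [^]\<^bsub>A\<^esub> ?m"
      using T.A.finprod_pow[OF finite_Syl l] by (simp add: T.transfer_def)
    finally have "M.transfer g \<otimes>\<^bsub>A\<^esub> ?t g [^]\<^bsub>A\<^esub> ?m = ?t g [^]\<^bsub>A\<^esub> ?m" .
    moreover have "M.transfer g \<in> carrier A" using M.transfer_hom g by (auto simp: hom_def)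
    ultimately show ?thesis using g by (metis T.A.nat_pow_closed T.A.r_cancel_one t.hom_closed)
  qed
  then have "mu n = \<one>\<^bsub>A\<^esub>"
    using lam_trivial_if_transfer_trivial[OF A ordA mu_hom _ n(1)] by blast
  moreover have "?t n = \<one>\<^bsub>A\<^esub>"
    using hom_abelian_p_residual[OF fin prime_p A ordA T.transfer_hom n(2)] .
  ultimately have "lam n [^]\<^bsub>A\<^esub> ?m = \<one>\<^bsub>A\<^esub>" using T.lam_closed[OF n(1)] by (simp add: mu_def)
  moreover have "lam n [^]\<^bsub>A\<^esub> (p ^ a) = \<one>\<^bsub>A\<^esub>"
    using T.A.pow_order_eq_1[OF T.lam_closed[OF n(1)]] a by simp
  moreover have "coprime ?m (p ^ a)" 
    using card_Syl_not_dvd prime_p by (simp add: coprime_commute prime_imp_coprime)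
  moreover have "?m > 0" using finite_Syl P_in_Syl by (auto simp: card_gt_0_iff)
  ultimately have "lam n \<in> {\<one>\<^bsub>A\<^esub>}"
    using T.A.coprime_pow_mem[OF T.A.triv_subgroup T.lam_closed[OF n(1)]] by simp
  then show ?thesis by simp
qed

text \<open>The map \<open>N \<rightarrow> G/A^p(G)\<close> has kernel \<open>A^p(N)\<close>: one inclusion is the minimality of \<open>A^p(N)\<close>, the other is
the previous lemma for the projection onto \<open>N/A^p(N)\<close>. It is onto, since the image of \<open>g\<close>, raised to
the number of Sylow subgroups, is a product of images of cocycle values in \<open>N\<close>, and that number is prime
to \<open>p\<close>.\<close>

theorem controls_p_transfer_N: "controls_p_transfer p G N"
proof -
  let ?N = "G\<lparr>carrier := N\<rparr>" and ?R = "abelian_p_residual p G"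
  let ?S = "abelian_p_residual p ?N" and ?Q = "G Mod ?R" and ?psi = "\<lambda>x. ?R #> x"
  interpret N: group ?N using subgroup_imp_group[OF N_subgroup] .
  have finN: "finite (carrier ?N)" using fin N_carrier finite_subset by auto
  have R: "?R \<lhd> G" "comm_group ?Q" "p_group p ?Q"
    using abelian_p_residual_mem[OF fin prime_p] by (auto simp: abelian_p_quotient_kernels_def)
  have S: "?S \<lhd> ?N" "comm_group (?N Mod ?S)" "p_group p (?N Mod ?S)"
    using N.abelian_p_residual_mem[OF finN prime_p] by (auto simp: abelian_p_quotient_kernels_def)
  interpret R: normal ?R G by (rule R)
  interpret S: normal ?S ?N by (rule S)
  interpret Q: comm_group ?Q by (rule R)
  have psi: "?psi \<in> hom G ?Q" using R.r_coset_hom_Mod .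
  have psiN: "?psi \<in> hom ?N ?Q"
  proof (rule homI)
    show "?psi x \<in> carrier ?Q" if "x \<in> carrier ?N" for x
      using that N_carrier by (auto simp: carrier_FactGroup)
    show "?psi (x \<otimes>\<^bsub>?N\<^esub> y) = ?psi x \<otimes>\<^bsub>?Q\<^esub> ?psi y"
      if "x \<in> carrier ?N" "y \<in> carrier ?N" for x y
      using that N_carrier R.rcos_sum[of x y] by auto
  qed
  interpret psi: group_hom ?N ?Q ?psi
    using psiN by (simp add: group_hom_def group_hom_axioms_def N.is_group Q.is_group)
  have "kernel ?N ?Q ?psi = ?S"
  proof
    show "?S \<subseteq> kernel ?N ?Q ?psi"
      using N.abelian_p_residual_least[OF finN prime_p] psi.kernel_abelian_p_quotient[OF R(2,3) prime_p]
      by blast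
    show "kernel ?N ?Q ?psi \<subseteq> ?S"
    proof
      fix n assume "n \<in> kernel ?N ?Q ?psi"
      then have n: "n \<in> N" "n \<in> ?R"
        using rcos_eq_self_iff[OF R.subgroup_axioms] N_carrier by (auto simp: kernel_def)
      have "?S #>\<^bsub>?N\<^esub> n = \<one>\<^bsub>?N Mod ?S\<^esub>"
        using lam_abelian_p_residual[OF S(2,3) S.r_coset_hom_Mod n] .
      then show "n \<in> ?S" using N.rcos_eq_self_iff[OF S.subgroup_axioms] n(1) by simp
    qed
  qed
  moreover have "?psi ` carrier ?N = carrier ?Q"
  proof
    show "?psi ` carrier ?N \<subseteq> carrier ?Q" by (rule image_subsetI) (rule psi.hom_closed)
    show "carrier ?Q \<subseteq> ?psi ` carrier ?N"
    proof
      fix C assume C: "C \<in> carrier ?Q"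
      then obtain g where g: "g \<in> carrier G" "C = ?psi g" by (auto simp: carrier_FactGroup)
      obtain a where a: "order ?Q = p ^ a" using R(3) by (auto simp: p_group_def)
      have "C [^]\<^bsub>?Q\<^esub> card Syl = finprod ?Q (\<lambda>Q. ?psi (cocycle Q g)) Syl"
        using finprod_hom_cocycle[OF R(2) psi g(1)] g(2) by simp
      also have "\<dots> \<in> ?psi ` carrier ?N"
        using cocycle_in_N[OF _ g(1)]
        by (intro Q.finprod_in_subgroup[OF psi.img_is_subgroup finite_Syl]) auto
      finally have "C [^]\<^bsub>?Q\<^esub> card Syl \<in> ?psi ` carrier ?N" .
      moreover have "C [^]\<^bsub>?Q\<^esub> (p ^ a) = \<one>\<^bsub>?Q\<^esub>" using Q.pow_order_eq_1[OF C] a by simp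
      moreover have "coprime (card Syl) (p ^ a)"
        using card_Syl_not_dvd prime_p by (simp add: coprime_commute prime_imp_coprime)
      moreover have "card Syl > 0" using finite_Syl P_in_Syl by (auto simp: card_gt_0_iff)
      ultimately show "C \<in> ?psi ` carrier ?N"
        using Q.coprime_pow_mem[OF psi.img_is_subgroup C] by blast
    qed
  qed
  ultimately have "?N Mod ?S \<cong> ?Q" using psi.FactGroup_iso by simp
  moreover have "coprime (card (rcosets N)) p"
  proof -
    have "order G = card (rcosets N) * p ^ multiplicity p (order G) * (card N div p ^ multiplicity p (order G))"
    proof -
      have "card P dvd card N"
        using N.card_subgroup_dvd[OF subgroup_in_subgroup[OF P_subgroup N_subgroup P_subset_N]]
        by (simp add: order_def)
      then show ?thesis using lagrange[OF N_subgroup] card_P by (simp add: mult.assoc)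
    qed
    then have "\<not> p dvd card (rcosets N) * (card N div p ^ multiplicity p (order G))"
      using not_dvd_cofactor[OF prime_p, of "order G"] fin order_gt_0_iff_finite
      by (simp add: mult_ac)
    then have "\<not> p dvd card (rcosets N)" by (metis dvd_mult2)
    then show ?thesis using prime_p by (simp add: coprime_commute prime_imp_coprime)
  qed
  ultimately show ?thesis using N_subgroup by (simp add: controls_p_transfer_def)
qed

end

text \<open>The normalizer \<open>M\<close> of \<open>P \<inter> Q\<close> is \<open>p\<close>-nilpotent with normal subgroup \<open>P \<inter> Q\<close>, and tameness says
that \<open>N_P(P \<inter> Q)\<close> and \<open>N_Q(P \<inter> Q)\<close> are Sylow subgroups of \<open>M\<close>.\<close>

lemma (in sylow_group) central_series_upper_central:
  assumes nilp: "\<And>Q. sylow_subgroup p G Q \<Longrightarrow> tame_intersection p G P Q \<Longrightarrow>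
      upper_central (G\<lparr>carrier := P\<rparr>) (p - 1) \<subset> P \<inter> Q \<Longrightarrow> P \<inter> Q \<subset> P \<Longrightarrow>
      p_nilpotent p (G\<lparr>carrier := normalizer G (P \<inter> Q)\<rparr>)"
  shows "central_series G p P (upper_central (G\<lparr>carrier := P\<rparr>))"
proof -
  let ?P = "G\<lparr>carrier := P\<rparr>"
  interpret P: group ?P using subgroup_imp_group[OF P_subgroup] .
  let ?W = "upper_central ?P"
  have W_sub: "?W j \<subseteq> P" for j using P.upper_central_subset by simp
  have W_subgroup: "subgroup (?W j) G" for j
    using incl_subgroup[OF P_subgroup] P.upper_central_normal normal_imp_subgroup by blast
  show ?thesis
  proof (intro central_series.intro central_series_axioms.intro tame_centralizer_fusion.intro
      tame_centralizer_fusion_axioms.intro sylow_group_axioms)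
    show "?W (p - 1) \<subseteq> P" by (rule W_sub)
    show "conj_set G n (?W (p - 1)) = ?W (p - 1)" if "n \<in> N" for n
      using conj_upper_central[OF P_subgroup] that mem_N_iff by blast
    show "?W 0 = {\<one>}" by simp
    show "subgroup (?W j) G" for j by (rule W_subgroup)
    show "?W j \<subseteq> P" for j by (rule W_sub)
    show "?W j \<subseteq> ?W (Suc j)" for j by (rule P.upper_central_mono)
    show "x \<otimes> g \<otimes> inv x \<otimes> inv g \<in> ?W j" if x: "x \<in> ?W (Suc j)" and g: "g \<in> P" for j x g
    proof -
      have "x \<in> P" using x W_sub by blast
      then show ?thesis
        using P.mem_upper_central_Suc[OF P.upper_central_normal, of x j] x g
          m_inv_consistent[OF P_subgroup] by simp
    qed
    show "conj_set G g (?W j) = ?W j" if g: "g \<in> P" for g j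
      using conj_upper_central[OF P_subgroup _ conj_set_self[OF P_subgroup g]] g P_carrier by blast
  next
    fix Q
    let ?R = "P \<inter> Q" and ?q = "p ^ multiplicity p (card (norm_in G (carrier G) (P \<inter> Q)))"
    assume Q: "Q \<in> Syl" and cP: "card (norm_in G P ?R) = ?q" and cQ: "card (norm_in G Q ?R) = ?q"
      and Z: "?W (p - 1) \<subset> ?R" and RP: "?R \<subset> P"
    have Qs: "subgroup Q G" using Syl_subgroup[OF Q] .
    have R: "subgroup ?R G" using subgroups_Inter_pair[OF P_subgroup Qs] .
    have RG: "?R \<subseteq> carrier G" using P_carrier by blast
    let ?M = "norm_in G (carrier G) ?R"
    have nM: "normalizer G ?R = ?M" using normalizer_eq_norm_in[OF RG] .
    have M: "subgroup ?M G" using subgroup_norm_in[OF subgroup_self RG] .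
    interpret M: group "G\<lparr>carrier := ?M\<rparr>" using subgroup_imp_group[OF M] .
    have sub: "subgroup (norm_in G H ?R) (G\<lparr>carrier := ?M\<rparr>)" if H: "subgroup H G" for H
      using subgroup_in_subgroup[OF subgroup_norm_in[OF H RG] M] subgroup.subset[OF H]
      by (auto simp: norm_in_def)
    have "sylow_subgroup p G Q"
      using Qs card_Syl_eq[OF Q] by (simp add: sylow_subgroup_def)
    moreover have "tame_intersection p G P Q"
      using normalizer_subgroup_eq_norm_in[OF P_subgroup, of ?R] normalizer_subgroup_eq_norm_in[OF Qs, of ?R]
        sub[OF P_subgroup] sub[OF Qs] cP cQ
      by (simp add: tame_intersection_def sylow_subgroup_def nM order_def)
    ultimately have nil: "p_nilpotent p (G\<lparr>carrier := ?M\<rparr>)" using nilp Z RP nM by metis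
    have RM: "?R \<subseteq> ?M" using conj_set_self[OF R] RG by (auto simp: norm_in_def)
    have RnM: "?R \<lhd> G\<lparr>carrier := ?M\<rparr>"
    proof -
      have "x \<otimes> r \<otimes> inv\<^bsub>G\<lparr>carrier := ?M\<rparr>\<^esub> x \<in> ?R" if x: "x \<in> ?M" and r: "r \<in> ?R" for x r
      proof -
        have "x \<otimes> r \<otimes> inv x \<in> conj_set G x ?R" using r by (auto simp: conj_set_def)
        then show ?thesis using x m_inv_consistent[OF M x] by (simp add: norm_in_def)
      qed
      then show ?thesis using M.normal_inv_iff subgroup_in_subgroup[OF R M RM] by simp
    qed
    obtain r where cR: "card ?R = p ^ r"
    proof -
      have "card ?R dvd card P"
        using P.card_subgroup_dvd[OF subgroup_in_subgroup[OF R P_subgroup]] by (simp add: order_def)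
      then show ?thesis using that card_P prime_p by (metis divides_primepow_nat)
    qed
    have "\<exists>c\<in>carrier (G\<lparr>carrier := ?M\<rparr>). (\<forall>x\<in>?R. c \<otimes>\<^bsub>G\<lparr>carrier := ?M\<rparr>\<^esub> x \<otimes>\<^bsub>G\<lparr>carrier := ?M\<rparr>\<^esub> inv\<^bsub>G\<lparr>carrier := ?M\<rparr>\<^esub> c = x)
        \<and> conj_set (G\<lparr>carrier := ?M\<rparr>) c (norm_in G P ?R) = norm_in G Q ?R"
    proof (rule M.p_nilpotent_sylow_conj_centralizing[OF _ prime_p nil RnM cR sub[OF P_subgroup] _ sub[OF Qs]])
      show "finite (carrier (G\<lparr>carrier := ?M\<rparr>))" using finite_subset[OF subgroup.subset[OF M] fin] by simp
    qed (simp_all add: cP cQ order_def)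
    then obtain c where c: "c \<in> ?M" "\<forall>x\<in>?R. c \<otimes> x \<otimes> inv\<^bsub>G\<lparr>carrier := ?M\<rparr>\<^esub> c = x"
      "conj_set (G\<lparr>carrier := ?M\<rparr>) c (norm_in G P ?R) = norm_in G Q ?R"
      by auto
    then show "\<exists>c\<in>carrier G. (\<forall>x\<in>?R. c \<otimes> x \<otimes> inv c = x)
        \<and> conj_set G c (norm_in G P ?R) = norm_in G Q ?R"
      using m_inv_consistent[OF M c(1)] conj_set_carrier_update[OF M c(1)] subgroup.subset[OF M]
      by (intro bexI[of _ c]) auto
  qed
qed

theorem theorem1p3:
  fixes G :: "('a, 'b) monoid_scheme" and p :: nat and P :: "'a set"
  assumes "group G" and "finite (carrier G)"
    and "Factorial_Ring.prime p" and "p dvd order G"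
    and "sylow_subgroup p G P"
    and "\<And>Q. sylow_subgroup p G Q \<Longrightarrow> tame_intersection p G P Q \<Longrightarrow>
           upper_central (G\<lparr>carrier := P\<rparr>) (p - 1) \<subset> P \<inter> Q \<Longrightarrow> P \<inter> Q \<subset> P \<Longrightarrow>
           p_nilpotent p (G\<lparr>carrier := normalizer G (P \<inter> Q)\<rparr>)"
  shows "controls_p_transfer p G (normalizer G P)"
proof -
  interpret group G by fact
  interpret S: sylow_group G p P
    using assms(1,2,3,5) by (simp add: sylow_group_def sylow_group_axioms_def sylow_subgroup_def)
  interpret C: central_series G p P "upper_central (G\<lparr>carrier := P\<rparr>)"
    using assms(6) by (rule S.central_series_upper_central)
  have "normalizer G P = S.N" using normalizer_eq_norm_in[OF S.P_carrier] by (simp add: S.N_def)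
  then show ?thesis using C.controls_p_transfer_N by simp
qed

end
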